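(* For every $n\ge 1$: (i) the two triples $(\mathrm{LMAX},\mathsf{iar},\mathsf{comp})$ and $(\mathrm{LMAX},\mathsf{comp},\mathsf{iar})$ have the same distribution over $\mathfrak{S}_n(321)$; (ii) the two quadruples $(\mathrm{LMAX},\mathrm{DESB},\mathsf{iar},\mathsf{comp})$ and $(\mathrm{LMAX},\mathrm{DESB},\mathsf{comp},\mathsf{iar})$ have the same distribution over $\mathfrak{S}_n(312)$; (iii) the two quadruples $(\mathrm{LMAX},\mathrm{LMIN},\mathsf{iar},\mathsf{comp})$ and $(\mathrm{LMAX},\mathrm{LMIN},\mathsf{comp},\mathsf{iar})$ have the same distribution over $\mathfrak{S}_n(132)$.
   Context: $\mathfrak{S}_n$ is the set of permutations $\pi=\pi(1)\cdots\pi(n)$ of $[n]=\{1,\dots,n\}$. A permutation $\pi\in\mathfrak{S}_n$ contains the pattern $\sigma\in\mathfrak{S}_k$ if there are $j_1<\cdots<j_k$ such that $\pi(j_a)<\pi(j_b)$ if and only if $\sigma(a)<\sigma(b)$ for all $1\le a<b\le k$; otherwise it avoids $\sigma$. $\mathfrak{S}_n(\sigma)$ is the set of permutations in $\mathfrak{S}_n$ avoiding $\sigma$. For $\pi\in\mathfrak{S}_n$: - $\mathrm{DES}(\pi)=\{i\in[n-1]:\pi(i)>\pi(i+1)\}$ (descent set); - $\mathsf{iar}(\pi)=\min(\mathrm{DES}(\pi)\cup\{n\})$ (length of the initial ascending run); - $\mathsf{comp}(\pi)=|\{i\in[n]:\pi(j)\le i\text{ for all }j\le i\}|$ (number of components);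 - $\mathrm{LMAX}(\pi)=\{\pi(i):\pi(j)<\pi(i)\text{ for all }1\le j<i\}$ (set of values of left-to-right maxima); - $\mathrm{LMIN}(\pi)=\{\pi(i):\pi(j)>\pi(i)\text{ for all }1\le j<i\}$ (set of values of left-to-right minima); - $\mathrm{DESB}(\pi)=\{\pi(i+1): i\in\mathrm{DES}(\pi)\}$ (set of descent bottoms). Two tuples of (possibly set-valued) statistics have the same distribution over a finite set if each tuple of values is attained by the same number of elements under both. *)

theory Defs
  imports "HOL-Combinatorics.Permutations"
begin

text \<open>A permutation of \<open>[n]\<close> is a function on \<^typ>\<open>nat\<close> that permutes \<open>{1..n}\<close> in the library's
  sense, so it is the identity outside \<open>{1..n}\<close>; positions and values are counted from 1.
  The length \<open>n\<close> cannot be recovered from the function and is passed explicitly.\<close>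

definition Sym :: "nat \<Rightarrow> (nat \<Rightarrow> nat) set" where
  "Sym n = {\<pi>. \<pi> permutes {1..n}}"

text \<open>The permutation with a given one-line notation \<open>\<sigma>(1) \<dots> \<sigma>(k)\<close>.\<close>

definition one_line :: "nat list \<Rightarrow> nat \<Rightarrow> nat" where
  "one_line w i = (if i \<in> {1..length w} then w ! (i - 1) else i)"

lemma one_line_in_Sym:
  assumes "set w = {1..length w}"
  shows "one_line w \<in> Sym (length w)"
proof -
  have "one_line w ` {1..length w} = {1..length w}"
  proof -
    have "one_line w ` {1..length w} = (\<lambda>i. w ! i) ` {..<length w}"
    proof (intro set_eqI iffI)
      fix x assume "x \<in> one_line w ` {1..length w}"
      then obtain i where "i \<in> {1..length w}" "x = w ! (i - 1)"
        by (auto simp: one_line_def)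
      then show "x \<in> (\<lambda>i. w ! i) ` {..<length w}"
        by (intro image_eqI[where x = "i - 1"]) auto
    next
      fix x assume "x \<in> (\<lambda>i. w ! i) ` {..<length w}"
      then obtain i where "i < length w" "x = w ! i" by auto
      then show "x \<in> one_line w ` {1..length w}"
        by (intro image_eqI[where x = "Suc i"]) (auto simp: one_line_def)
    qed
    also have "\<dots> = set w" by (auto simp: set_conv_nth)
    finally show ?thesis using assms by simp
  qed
  then have "bij_betw (one_line w) {1..length w} {1..length w}"
    by (simp add: bij_betw_def eq_card_imp_inj_on)
  then show ?thesis
    unfolding Sym_def by (auto intro!: bij_imp_permutes simp: one_line_def)
qed

definition contains_pattern :: "nat \<Rightarrow> (nat \<Rightarrow> nat) \<Rightarrow> nat \<Rightarrow> (nat \<Rightarrow> nat) \<Rightarrow> bool" where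
  "contains_pattern n \<pi> k \<sigma> \<longleftrightarrow>
     (\<exists>j. strict_mono_on {1..k} j \<and> j ` {1..k} \<subseteq> {1..n} \<and>
        (\<forall>a b. 1 \<le> a \<and> a < b \<and> b \<le> k \<longrightarrow> (\<pi> (j a) < \<pi> (j b) \<longleftrightarrow> \<sigma> a < \<sigma> b)))"

text \<open>Permutations of \<open>[n]\<close> avoiding the pattern with one-line notation \<open>w\<close>.\<close>

definition Av :: "nat \<Rightarrow> nat list \<Rightarrow> (nat \<Rightarrow> nat) set" where
  "Av n w = {\<pi> \<in> Sym n. \<not> contains_pattern n \<pi> (length w) (one_line w)}"

definition DES :: "nat \<Rightarrow> (nat \<Rightarrow> nat) \<Rightarrow> nat set" where
  "DES n \<pi> = {i \<in> {1..n-1}. \<pi> i > \<pi> (i + 1)}"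

definition iar :: "nat \<Rightarrow> (nat \<Rightarrow> nat) \<Rightarrow> nat" where
  "iar n \<pi> = Min (DES n \<pi> \<union> {n})"

text \<open>The statistic \<open>comp\<close>, renamed because \<^const>\<open>comp\<close> is function composition.\<close>

definition comps :: "nat \<Rightarrow> (nat \<Rightarrow> nat) \<Rightarrow> nat" where
  "comps n \<pi> = card {i \<in> {1..n}. \<forall>j \<in> {1..i}. \<pi> j \<le> i}"

definition LMAX :: "nat \<Rightarrow> (nat \<Rightarrow> nat) \<Rightarrow> nat set" where
  "LMAX n \<pi> = {\<pi> i | i. i \<in> {1..n} \<and> (\<forall>j \<in> {1..<i}. \<pi> j < \<pi> i)}"

definition LMIN :: "nat \<Rightarrow> (nat \<Rightarrow> nat) \<Rightarrow> nat set" where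
  "LMIN n \<pi> = {\<pi> i | i. i \<in> {1..n} \<and> (\<forall>j \<in> {1..<i}. \<pi> j > \<pi> i)}"

definition DESB :: "nat \<Rightarrow> (nat \<Rightarrow> nat) \<Rightarrow> nat set" where
  "DESB n \<pi> = {\<pi> (i + 1) | i. i \<in> DES n \<pi>}"

text \<open>Meaningful for finite \<open>S\<close> only, since \<^const>\<open>card\<close> is 0 on infinite sets.\<close>

definition equidistributed :: "'a set \<Rightarrow> ('a \<Rightarrow> 'b) \<Rightarrow> ('a \<Rightarrow> 'b) \<Rightarrow> bool" where
  "equidistributed S f g \<longleftrightarrow> (\<forall>v. card {x \<in> S. f x = v} = card {x \<in> S. g x = v})"

lemma finite_Av: "finite (Av n w)"
  by (rule finite_subset[OF _ finite_permutations[of "{1..n}"]]) (auto simp: Av_def Sym_def)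

end

theory Submission
  imports Defs
begin

text \<open>
  Parts (i) and (ii) are one statement about prefix maxima. A permutation avoiding 321 or 312 is
  determined by its function \<open>g i = max (\<pi> 1, \<dots>, \<pi> i)\<close>, and in either class every weakly
  increasing function \<open>g\<close> on \<open>[n]\<close> with \<open>i \<le> g i\<close> and \<open>g n = n\<close> occurs (\<open>bij_betw_pmax\<close>). The range
  of \<open>g\<close> is \<open>LMAX\<close>;
  the fixed points of \<open>g\<close> are the ends of the components; and the first \<open>i\<close> with
  \<open>g (i + 1) = g i\<close> is the first descent. On 312-avoiders the descent bottoms are exactly the values
  outside \<open>LMAX\<close>, so \<open>DESB\<close> carries no information beyond \<open>LMAX\<close>.

  For a fixed range \<open>v\<^sub>1 < \<dots> < v\<^sub>k = n\<close> let \<open>q\<^sub>j\<close> be the number of positions \<open>i\<close> with \<open>g i \<le> v\<^sub>j\<close>.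
  Then \<open>j \<le> q\<^sub>j \<le> v\<^sub>j\<close>, and \<open>r\<^sub>j = q\<^sub>j - j\<close> for \<open>j < k\<close> is an arbitrary weakly increasing sequence with
  \<open>0 \<le> r\<^sub>j \<le> u\<^sub>j = v\<^sub>j - j\<close>. In these terms \<open>iar - 1\<close> counts the zeros of \<open>r\<close> and \<open>comp - 1\<close> counts its
  contacts \<open>r\<^sub>j = u\<^sub>j\<close>. If \<open>u\<^sub>1 > 0\<close>, deleting the first contact and inserting a zero in front
  trades one contact for one zero, reversibly: the entries moved to the right were strictly below
  the ceiling and stay so. Hence the number of sequences with \<open>a\<close> zeros and \<open>b\<close> contacts depends
  on \<open>a + b\<close> only and is symmetric in \<open>a\<close> and \<open>b\<close> (\<open>card_zeros_contacts_symmetric\<close>).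
  If \<open>u\<^sub>1 = 0\<close>, the first entry is a zero and a contact, and it can be removed.

  Part (iii) has a more direct reason. In a 132-avoider the values above the first entry increase, so
  \<open>LMAX\<close> is the interval from \<open>\<pi> 1 = max LMIN\<close> to \<open>n\<close>. If \<open>\<pi> 1 \<noteq> 1\<close>, the initial run is a sequence
  of consecutive values \<open>\<pi> 1, \<pi> 1 + 1, \<dots>\<close> and all components except the first are single points at
  the end. Removing the first entry of a run of length at least 2, closing the gap in the values,
  and appending the new maximum at the end therefore shortens the run by 1, adds one component,
  and preserves \<open>LMIN\<close> (\<open>card_slide\<close>). Again the counts depend on the sum of
  the two statistics only. The case \<open>\<pi> 1 = 1\<close> is the identity, where both statistics equal \<open>n\<close>.
\<close>

section \<open>Symmetry of a pair of statistics\<close>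

text \<open>The statistics \<open>f\<close> and \<open>g\<close> are exchangeable for each value of \<open>K\<close>. The
  quadruples ask for this with \<open>K\<close> a pair of sets; since one set of each pair determines the other, it
  suffices to treat a single set, and the next lemma passes from \<open>K\<close> to any \<open>A\<close> that carries the same information.\<close>

definition jointly_symmetric :: "'a set \<Rightarrow> ('a \<Rightarrow> 'k) \<Rightarrow> ('a \<Rightarrow> nat) \<Rightarrow> ('a \<Rightarrow> nat) \<Rightarrow> bool" where
  "jointly_symmetric S K f g \<longleftrightarrow>
     (\<forall>k a b. card {x \<in> S. K x = k \<and> f x = a \<and> g x = b} =
              card {x \<in> S. K x = k \<and> f x = b \<and> g x = a})"

lemma equidistributed_if_jointly_symmetric:
  fixes A :: "'a \<Rightarrow> 'c"
  assumes sym: "jointly_symmetric S K f g" and A: "\<And>x. x \<in> S \<Longrightarrow> A x = h (K x)"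
    and K: "\<And>x. x \<in> S \<Longrightarrow> K x = h' (A x)"
  shows "equidistributed S (\<lambda>x. (A x, f x, g x)) (\<lambda>x. (A x, g x, f x))"
  unfolding equidistributed_def
proof
  fix v :: "'c \<times> nat \<times> nat"
  obtain c a b where v: "v = (c, a, b)" by (cases v)
  show "card {x \<in> S. (A x, f x, g x) = v} = card {x \<in> S. (A x, g x, f x) = v}"
  proof (cases "h (h' c) = c")
    case True
    have eq: "A x = c \<longleftrightarrow> K x = h' c" if "x \<in> S" for x
      using A[OF that] K[OF that] True by auto
    have "{x \<in> S. (A x, f x, g x) = v} = {x \<in> S. K x = h' c \<and> f x = a \<and> g x = b}"
      using eq v by auto
    moreover have "{x \<in> S. (A x, g x, f x) = v} = {x \<in> S. K x = h' c \<and> f x = b \<and> g x = a}"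
      using eq v by auto
    ultimately show ?thesis using sym by (simp add: jointly_symmetric_def)
  next
    case False
    then have "A x \<noteq> c" if "x \<in> S" for x
      using A[OF that] K[OF that] by auto
    then have "{x \<in> S. (A x, f x, g x) = v} = {}" "{x \<in> S. (A x, g x, f x) = v} = {}"
      using v by auto
    then show ?thesis by (simp only:)
  qed
qed

lemma equidistributed_quadruple:
  fixes A :: "'a \<Rightarrow> 'c" and B :: "'a \<Rightarrow> 'd" and f g :: "'a \<Rightarrow> 'e"
  assumes "equidistributed S (\<lambda>x. ((A x, B x), f x, g x)) (\<lambda>x. ((A x, B x), g x, f x))"
  shows "equidistributed S (\<lambda>x. (A x, B x, f x, g x)) (\<lambda>x. (A x, B x, g x, f x))"
  unfolding equidistributed_def
proof
  fix v :: "'c \<times> 'd \<times> 'e \<times> 'e"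
  obtain c d a b where v: "v = (c, d, a, b)" by (cases v)
  show "card {x \<in> S. (A x, B x, f x, g x) = v} = card {x \<in> S. (A x, B x, g x, f x) = v}"
    using assms[unfolded equidistributed_def, rule_format, of "((c, d), a, b)"] by (simp add: v)
qed

text \<open>A bijection that lowers one statistic by 1 and raises the other by 1 moves along an antidiagonal of
  the table \<open>N\<close>; the reflected entry lies on the same antidiagonal. The threshold \<open>m\<close> is there because
  such a bijection cannot be continued past the smallest value that the statistics take.\<close>

lemma symmetric_if_constant_on_antidiagonals:
  fixes N :: "nat \<Rightarrow> nat \<Rightarrow> nat"
  assumes step: "\<And>a b. m \<le> a \<Longrightarrow> m \<le> b \<Longrightarrow> N (Suc a) b = N a (Suc b)"
    and zero: "\<And>a b. a < m \<or> b < m \<Longrightarrow> N a b = 0"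
  shows "N a b = N b a"
proof (cases "a < m \<or> b < m")
  case True
  then show ?thesis using zero by metis
next
  case False
  have *: "N (a + d) b = N a (b + d)" if "m \<le> a" "m \<le> b" for a b d
    using that
  proof (induction d arbitrary: b)
    case (Suc d)
    then show ?case using step[of "a + d" b] Suc.IH[of "Suc b"] by simp
  qed simp
  show ?thesis
  proof (cases "a \<le> b")
    case True
    then show ?thesis using *[of a a "b - a"] False by simp
  next
    case f: False
    then show ?thesis using *[of b b "a - b"] False by simp
  qed
qed

section \<open>Zeros and contacts of weakly increasing sequences\<close>

text \<open>Read as heights of the horizontal steps, these are the lattice paths between the axis and a fixed
  upper boundary \<open>u\<close>; \<open>zeros\<close> and \<open>contacts\<close> are the steps shared with the lower and the upper boundary.\<close>

definition weakly_below :: "nat list \<Rightarrow> nat list set" where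
  "weakly_below u = {r. sorted r \<and> list_all2 (\<le>) r u}"

definition zeros :: "nat list \<Rightarrow> nat" where
  "zeros r = length (filter (\<lambda>x. x = 0) r)"

definition contacts :: "nat list \<Rightarrow> nat list \<Rightarrow> nat" where
  "contacts u r = length (filter (\<lambda>(x, y). x = y) (zip r u))"

fun drop_contact :: "nat list \<Rightarrow> nat list \<Rightarrow> nat list" where
  "drop_contact (u # us) (x # xs) = (if x = u then xs else x # drop_contact us xs)"
| "drop_contact _ _ = []"

text \<open>Inserts a contact at the first place where the result stays weakly increasing. Before that place the
  entries of the second list, which are matched here with the ceiling at their position after the
  insertion, lie strictly below it; so the inserted entry is the first contact and \<open>drop_contact\<close>
  recovers it.\<close>

fun add_contact :: "nat list \<Rightarrow> nat list \<Rightarrow> nat list" where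
  "add_contact (u # us) [] = [u]"
| "add_contact (u # us) (x # xs) = (if u \<le> x then u # x # xs else x # add_contact us xs)"
| "add_contact [] xs = []"

text \<open>The entry \<open>y\<close> is the one that the shift pushes in at the front. In the induction it is the entry of \<open>r\<close>
  just passed, which is strictly below the ceiling because no contact has been met yet; as the
  ceiling increases weakly, \<open>y\<close> is strictly below it at its new position as well and creates no
  contact.\<close>

lemma drop_contact:
  assumes "sorted u" "sorted (y # r)" "list_all2 (\<le>) r u" "contacts u r > 0" "y < hd u"
  shows "y # drop_contact u r \<in> weakly_below u"
    and "Suc (contacts u (y # drop_contact u r)) = contacts u r"
    and "zeros (drop_contact u r) = zeros r"
    and "add_contact u (drop_contact u r) = r"
proof -
  have "y # drop_contact u r \<in> weakly_below u \<and>
    Suc (contacts u (y # drop_contact u r)) = contacts u r \<and>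
    zeros (drop_contact u r) = zeros r \<and> add_contact u (drop_contact u r) = r"
    using assms
  proof (induction u r arbitrary: y rule: drop_contact.induct)
    case (1 u us x xs)
    show ?case
    proof (cases "x = u")
      case True
      then show ?thesis using 1(2-)
        by (cases xs) (auto simp: weakly_below_def contacts_def zeros_def)
    next
      case False
      then have "us \<noteq> []" using 1(2-) by (auto simp: contacts_def)
      then have "x < hd us" "sorted us" using False 1(2-) by (cases us; auto)+
      moreover have "contacts us xs > 0" using False 1(2-) by (auto simp: contacts_def)
      ultimately show ?thesis using 1(1)[of x] 1(2-) False
        by (cases "drop_contact us xs"; cases us; auto simp: weakly_below_def contacts_def zeros_def)
    qed
  qed (auto simp: contacts_def)
  then show "y # drop_contact u r \<in> weakly_below u"
    "Suc (contacts u (y # drop_contact u r)) = contacts u r"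
    "zeros (drop_contact u r) = zeros r" "add_contact u (drop_contact u r) = r"
    by auto
qed

text \<open>The converse of the previous lemma, with the same role for \<open>y\<close>: here it is the entry that leaves.\<close>

lemma add_contact:
  assumes "sorted u" "y # s \<in> weakly_below u" "y < hd u"
  shows "sorted (y # add_contact u s)"
    and "list_all2 (\<le>) (add_contact u s) u"
    and "contacts u (add_contact u s) = Suc (contacts u (y # s))"
    and "zeros (add_contact u s) = zeros s"
    and "drop_contact u (add_contact u s) = s"
proof -
  have "sorted (y # add_contact u s) \<and> list_all2 (\<le>) (add_contact u s) u \<and>
    contacts u (add_contact u s) = Suc (contacts u (y # s)) \<and>
    zeros (add_contact u s) = zeros s \<and> drop_contact u (add_contact u s) = s"
    using assms
  proof (induction u s arbitrary: y rule: add_contact.induct)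
    case (1 u us)
    then show ?case by (auto simp: weakly_below_def contacts_def zeros_def)
  next
    case (2 u us x xs)
    show ?case
    proof (cases "u \<le> x")
      case True
      then show ?thesis using 2(2-)
        by (auto simp: weakly_below_def contacts_def zeros_def)
    next
      case False
      then have "sorted us" "x # xs \<in> weakly_below us" "x < hd us"
        using 2(2-) by (cases us; auto simp: weakly_below_def)+
      then show ?thesis using 2(1)[of x] 2(2-) False
        by (auto simp: weakly_below_def contacts_def zeros_def)
    qed
  qed (auto simp: weakly_below_def)
  then show "sorted (y # add_contact u s)" "list_all2 (\<le>) (add_contact u s) u"
    "contacts u (add_contact u s) = Suc (contacts u (y # s))"
    "zeros (add_contact u s) = zeros s" "drop_contact u (add_contact u s) = s"
    by auto
qed

lemma zeros_Cons_0: "zeros (0 # s) = Suc (zeros s)"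
  by (simp add: zeros_def)

text \<open>The assumption \<open>0 < hd u\<close> keeps zeros and contacts apart, so that the deleted contact is not a zero
  and the inserted zero is not a contact.\<close>

lemma card_trade_contact_for_zero:
  assumes u: "sorted u" "u \<noteq> []" "0 < hd u"
  shows "card {r \<in> weakly_below u. zeros r = Suc a \<and> contacts u r = b} =
    card {r \<in> weakly_below u. zeros r = a \<and> contacts u r = Suc b}" (is "card ?A = card ?B")
proof -
  have *: "s = 0 # tl s" if "s \<in> ?A" for s
  proof -
    have "filter (\<lambda>x. x = 0) s \<noteq> []" "sorted s"
      using that by (auto simp: zeros_def weakly_below_def)
    then show ?thesis by (cases s) (force simp: filter_empty_conv split: if_splits)+
  qed
  have "bij_betw (\<lambda>s. add_contact u (tl s)) ?A ?B"
  proof (rule bij_betw_byWitness[where f' = "\<lambda>r. 0 # drop_contact u r"])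
    show "\<forall>s\<in>?A. 0 # drop_contact u (add_contact u (tl s)) = s"
    proof
      fix s assume s: "s \<in> ?A"
      then have "0 # tl s \<in> weakly_below u" using *[OF s] by auto
      then show "0 # drop_contact u (add_contact u (tl s)) = s"
        using add_contact(5)[OF u(1) _ u(3)] *[OF s] by metis
    qed
    show "\<forall>r\<in>?B. add_contact u (tl (0 # drop_contact u r)) = r"
      using drop_contact(4)[OF u(1) _ _ _ u(3)] by (auto simp: weakly_below_def)
    show "(\<lambda>s. add_contact u (tl s)) ` ?A \<subseteq> ?B"
    proof (rule image_subsetI)
      fix s assume s: "s \<in> ?A"
      then have w: "0 # tl s \<in> weakly_below u" using *[OF s] by auto
      note a = add_contact[OF u(1) w u(3)]
      show "add_contact u (tl s) \<in> ?B"
        using a s zeros_Cons_0[of "tl s"] *[OF s] by (auto simp: weakly_below_def)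
    qed
    show "(\<lambda>r. 0 # drop_contact u r) ` ?B \<subseteq> ?A"
    proof (rule image_subsetI)
      fix r assume r: "r \<in> ?B"
      then have "sorted (0 # r)" "list_all2 (\<le>) r u" "contacts u r > 0"
        by (auto simp: weakly_below_def)
      note a = drop_contact[OF u(1) this u(3)]
      show "0 # drop_contact u r \<in> ?A"
        using a r zeros_Cons_0 by auto
    qed
  qed
  then show ?thesis by (rule bij_betw_same_card)
qed

lemma card_zeros_contacts_symmetric:
  assumes "sorted u"
  shows "card {r \<in> weakly_below u. zeros r = a \<and> contacts u r = b} =
    card {r \<in> weakly_below u. zeros r = b \<and> contacts u r = a}"
  using assms
proof (induction u arbitrary: a b)
  case Nil
  have "{r \<in> weakly_below []. zeros r = a \<and> contacts [] r = b} =
    {r \<in> weakly_below []. zeros r = b \<and> contacts [] r = a}"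
    by (auto simp: weakly_below_def zeros_def contacts_def)
  then show ?case by simp
next
  case (Cons v u)
  show ?case
  proof (cases "v = 0")
    case True
    have "weakly_below (0 # u) = (#) 0 ` weakly_below u"
      by (auto simp: weakly_below_def list_all2_Cons2)
    then have *: "{r \<in> weakly_below (0 # u). zeros r = a \<and> contacts (0 # u) r = b} =
        (#) 0 ` {r \<in> weakly_below u. Suc (zeros r) = a \<and> Suc (contacts u r) = b}" for a b
      by (auto simp: zeros_def contacts_def)
    have "card {r \<in> weakly_below u. Suc (zeros r) = a \<and> Suc (contacts u r) = b} =
      card {r \<in> weakly_below u. Suc (zeros r) = b \<and> Suc (contacts u r) = a}"
      using Cons by (cases a; cases b) auto
    then show ?thesis unfolding True * by (simp add: card_image)
  next
    case False
    show ?thesis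
      by (rule symmetric_if_constant_on_antidiagonals[of 0])
        (use False Cons.prems card_trade_contact_for_zero[of "v # u"] in auto)
  qed
qed

section \<open>Permutations and patterns of length three\<close>

lemma SymI:
  assumes "\<And>i. i \<in> {1..n} \<Longrightarrow> \<pi> i \<in> {1..n}" "inj_on \<pi> {1..n}" "\<And>i. i \<notin> {1..n} \<Longrightarrow> \<pi> i = i"
  shows "\<pi> \<in> Sym n"
proof -
  have "\<pi> ` {1..n} \<subseteq> {1..n}" using assms(1) by blast
  then have "bij_betw \<pi> {1..n} {1..n}"
    using assms(2) endo_inj_surj[of "{1..n}" \<pi>] by (simp add: bij_betw_def)
  then show ?thesis using assms(3) by (auto simp: Sym_def intro!: bij_imp_permutes)
qed

lemma Sym_inj: "\<pi> \<in> Sym n \<Longrightarrow> \<pi> i = \<pi> j \<longleftrightarrow> i = j"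
  by (auto simp: Sym_def dest: permutes_inj injD)

lemma Sym_in: "\<pi> \<in> Sym n \<Longrightarrow> \<pi> i \<in> {1..n} \<longleftrightarrow> i \<in> {1..n}"
  by (simp only: Sym_def mem_Collect_eq permutes_in_image)

lemma Sym_bounds: "\<pi> \<in> Sym n \<Longrightarrow> 1 \<le> i \<Longrightarrow> i \<le> n \<Longrightarrow> 1 \<le> \<pi> i \<and> \<pi> i \<le> n"
  using Sym_in[of \<pi> n i] by simp

lemma Sym_outside: "\<pi> \<in> Sym n \<Longrightarrow> i \<notin> {1..n} \<Longrightarrow> \<pi> i = i"
  by (auto simp: Sym_def permutes_def)

lemma Sym_surj:
  assumes "\<pi> \<in> Sym n" "1 \<le> v" "v \<le> n"
  obtains i where "1 \<le> i" "i \<le> n" "\<pi> i = v"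
proof -
  have "v \<in> \<pi> ` {1..n}" using assms by (simp add: Sym_def permutes_image)
  then show ?thesis using that by auto
qed

lemma contains_pattern_3:
  "contains_pattern n \<pi> (length [x, y, z]) (one_line [x, y, z]) \<longleftrightarrow>
    (\<exists>i j k. 1 \<le> i \<and> i < j \<and> j < k \<and> k \<le> n \<and>
      (\<pi> i < \<pi> j \<longleftrightarrow> x < y) \<and> (\<pi> i < \<pi> k \<longleftrightarrow> x < z) \<and> (\<pi> j < \<pi> k \<longleftrightarrow> y < z))"
    (is "?L \<longleftrightarrow> ?R")
proof -
  have len: "length [x, y, z] = 3" by simp
  have i3: "{1..3::nat} = {1, 2, 3}" by auto
  have ol: "one_line [x, y, z] 1 = x" "one_line [x, y, z] 2 = y" "one_line [x, y, z] 3 = z"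
    by (simp_all add: one_line_def numeral_2_eq_2 numeral_3_eq_3)
  show ?thesis
  proof
    assume ?L
    then obtain j where j: "strict_mono_on {1..3} j" "j ` {1..3} \<subseteq> {1..n}"
      and p: "\<And>a b. 1 \<le> a \<and> a < b \<and> b \<le> (3::nat) \<Longrightarrow>
        (\<pi> (j a) < \<pi> (j b)) = (one_line [x, y, z] a < one_line [x, y, z] b)"
      unfolding contains_pattern_def len by blast
    have "j 1 < j 2" "j 2 < j 3" using j(1) by (auto simp: strict_mono_on_def)
    moreover have "j 1 \<in> {1..n}" "j 3 \<in> {1..n}" using j(2)
      by (auto simp: image_subset_iff simp del: One_nat_def)
    ultimately show ?R using p[of 1 2] p[of 1 3] p[of 2 3]
      by (intro exI[of _ "j 1"] exI[of _ "j 2"] exI[of _ "j 3"]) (simp add: ol[simplified])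
  next
    assume ?R
    then obtain i j k where ijk: "1 \<le> i" "i < j" "j < k" "k \<le> n"
      and p: "\<pi> i < \<pi> j \<longleftrightarrow> x < y" "\<pi> i < \<pi> k \<longleftrightarrow> x < z" "\<pi> j < \<pi> k \<longleftrightarrow> y < z"
      by auto
    define f where "f = (\<lambda>a::nat. if a = 1 then i else if a = 2 then j else k)"
    have "strict_mono_on {1..3} f" using ijk by (auto simp: strict_mono_on_def i3 f_def)
    moreover have "f ` {1..3} \<subseteq> {1..n}" using ijk by (auto simp: i3 f_def)
    moreover have "(\<pi> (f a) < \<pi> (f b)) = (one_line [x, y, z] a < one_line [x, y, z] b)"
      if "1 \<le> a \<and> a < b \<and> b \<le> 3" for a b
    proof -
      from that consider "a = 1" "b = 2" | "a = 1" "b = 3" | "a = 2" "b = 3" by linarith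
      then show ?thesis by cases (use p ol in \<open>simp_all add: f_def\<close>)
    qed
    ultimately show ?L unfolding contains_pattern_def len by blast
  qed
qed

lemma in_Av_321:
  "\<pi> \<in> Av n [3, 2, 1] \<longleftrightarrow>
    \<pi> \<in> Sym n \<and> \<not> (\<exists>i j k. 1 \<le> i \<and> i < j \<and> j < k \<and> k \<le> n \<and> \<pi> k < \<pi> j \<and> \<pi> j < \<pi> i)"
proof (cases "\<pi> \<in> Sym n")
  case True
  have neq: "\<pi> a \<noteq> \<pi> b" if "a < b" for a b using Sym_inj[OF True] that by simp
  have "(\<exists>i j k. 1 \<le> i \<and> i < j \<and> j < k \<and> k \<le> n \<and>
      (\<pi> i < \<pi> j \<longleftrightarrow> (3::nat) < 2) \<and> (\<pi> i < \<pi> k \<longleftrightarrow> (3::nat) < 1) \<and> (\<pi> j < \<pi> k \<longleftrightarrow> (2::nat) < 1))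
    \<longleftrightarrow> (\<exists>i j k. 1 \<le> i \<and> i < j \<and> j < k \<and> k \<le> n \<and> \<pi> k < \<pi> j \<and> \<pi> j < \<pi> i)"
    (is "(\<exists>i j k. ?P i j k) \<longleftrightarrow> (\<exists>i j k. ?Q i j k)")
  proof -
    have "?P i j k \<longleftrightarrow> ?Q i j k" for i j k
      using neq[of i j] neq[of i k] neq[of j k] by auto
    then show ?thesis by blast
  qed
  then show ?thesis using True by (simp only: Av_def mem_Collect_eq contains_pattern_3 simp_thms)
qed (simp add: Av_def)

lemma in_Av_312:
  "\<pi> \<in> Av n [3, 1, 2] \<longleftrightarrow>
    \<pi> \<in> Sym n \<and> \<not> (\<exists>i j k. 1 \<le> i \<and> i < j \<and> j < k \<and> k \<le> n \<and> \<pi> j < \<pi> k \<and> \<pi> k < \<pi> i)"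
proof (cases "\<pi> \<in> Sym n")
  case True
  have neq: "\<pi> a \<noteq> \<pi> b" if "a < b" for a b using Sym_inj[OF True] that by simp
  have "(\<exists>i j k. 1 \<le> i \<and> i < j \<and> j < k \<and> k \<le> n \<and>
      (\<pi> i < \<pi> j \<longleftrightarrow> (3::nat) < 1) \<and> (\<pi> i < \<pi> k \<longleftrightarrow> (3::nat) < 2) \<and> (\<pi> j < \<pi> k \<longleftrightarrow> (1::nat) < 2))
    \<longleftrightarrow> (\<exists>i j k. 1 \<le> i \<and> i < j \<and> j < k \<and> k \<le> n \<and> \<pi> j < \<pi> k \<and> \<pi> k < \<pi> i)"
    (is "(\<exists>i j k. ?P i j k) \<longleftrightarrow> (\<exists>i j k. ?Q i j k)")
  proof -
    have "?P i j k \<longleftrightarrow> ?Q i j k" for i j k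
      using neq[of i j] neq[of i k] neq[of j k] by auto
    then show ?thesis by blast
  qed
  then show ?thesis using True by (simp only: Av_def mem_Collect_eq contains_pattern_3 simp_thms)
qed (simp add: Av_def)

lemma in_Av_132:
  "\<pi> \<in> Av n [1, 3, 2] \<longleftrightarrow>
    \<pi> \<in> Sym n \<and> \<not> (\<exists>i j k. 1 \<le> i \<and> i < j \<and> j < k \<and> k \<le> n \<and> \<pi> i < \<pi> k \<and> \<pi> k < \<pi> j)"
proof (cases "\<pi> \<in> Sym n")
  case True
  have neq: "\<pi> a \<noteq> \<pi> b" if "a < b" for a b using Sym_inj[OF True] that by simp
  have "(\<exists>i j k. 1 \<le> i \<and> i < j \<and> j < k \<and> k \<le> n \<and>
      (\<pi> i < \<pi> j \<longleftrightarrow> (1::nat) < 3) \<and> (\<pi> i < \<pi> k \<longleftrightarrow> (1::nat) < 2) \<and> (\<pi> j < \<pi> k \<longleftrightarrow> (3::nat) < 2))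
    \<longleftrightarrow> (\<exists>i j k. 1 \<le> i \<and> i < j \<and> j < k \<and> k \<le> n \<and> \<pi> i < \<pi> k \<and> \<pi> k < \<pi> j)"
    (is "(\<exists>i j k. ?P i j k) \<longleftrightarrow> (\<exists>i j k. ?Q i j k)")
  proof -
    have "?P i j k \<longleftrightarrow> ?Q i j k" for i j k
      using neq[of i j] neq[of i k] neq[of j k] by auto
    then show ?thesis by blast
  qed
  then show ?thesis using True by (simp only: Av_def mem_Collect_eq contains_pattern_3 simp_thms)
qed (simp add: Av_def)

lemma Av_Sym: "\<pi> \<in> Av n w \<Longrightarrow> \<pi> \<in> Sym n"
  by (simp add: Av_def)

lemma Av_321D:
  "\<pi> \<in> Av n [3, 2, 1] \<Longrightarrow> 1 \<le> i \<Longrightarrow> i < j \<Longrightarrow> j < k \<Longrightarrow>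
    k \<le> n \<Longrightarrow> \<pi> k < \<pi> j \<Longrightarrow> \<pi> j < \<pi> i \<Longrightarrow> False"
  unfolding in_Av_321 by blast

lemma Av_312D:
  "\<pi> \<in> Av n [3, 1, 2] \<Longrightarrow> 1 \<le> i \<Longrightarrow> i < j \<Longrightarrow> j < k \<Longrightarrow>
    k \<le> n \<Longrightarrow> \<pi> j < \<pi> k \<Longrightarrow> \<pi> k < \<pi> i \<Longrightarrow> False"
  unfolding in_Av_312 by blast

lemma Av_132D:
  "\<pi> \<in> Av n [1, 3, 2] \<Longrightarrow> 1 \<le> i \<Longrightarrow> i < j \<Longrightarrow> j < k \<Longrightarrow>
    k \<le> n \<Longrightarrow> \<pi> i < \<pi> k \<Longrightarrow> \<pi> k < \<pi> j \<Longrightarrow> False"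
  unfolding in_Av_132 by blast

lemma finite_DES: "finite (DES n \<pi>)"
  by (rule finite_subset[of _ "{1..n-1}"]) (auto simp: DES_def)

lemma iar_pos: "n \<ge> 1 \<Longrightarrow> 1 \<le> iar n \<pi>"
  using finite_DES[of n \<pi>] by (auto simp: iar_def DES_def Suc_le_eq Min_gr_iff)

lemma comps_pos:
  assumes "\<pi> \<in> Sym n" "n \<ge> 1" shows "1 \<le> comps n \<pi>"
proof -
  have "n \<in> {i \<in> {1..n}. \<forall>j \<in> {1..i}. \<pi> j \<le> i}"
    using assms Sym_bounds by auto
  then show ?thesis by (auto simp: comps_def Suc_le_eq card_gt_0_iff)
qed

section \<open>Prefix maxima\<close>

text \<open>Including position 0, where every permutation of \<open>{1..n}\<close> has the value 0, changes no maximum and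
  avoids a default value for the empty prefix.\<close>

definition pmax :: "(nat \<Rightarrow> nat) \<Rightarrow> nat \<Rightarrow> nat" where
  "pmax \<pi> i = Max (\<pi> ` {..i})"

text \<open>The possible prefix maximum functions of permutations of \<open>{1..n}\<close>. Outside \<open>{1..n}\<close> the values are
  fixed, as they are for the permutations, so that a function is determined by its values on \<open>{1..n}\<close>.\<close>

definition ceilings :: "nat \<Rightarrow> (nat \<Rightarrow> nat) set" where
  "ceilings n = {g. mono g \<and> (\<forall>i. i \<le> g i) \<and> g 0 = 0 \<and> (\<forall>i\<ge>n. g i = i)}"

lemma ceilingsD:
  assumes "g \<in> ceilings n"
  shows "i \<le> j \<Longrightarrow> g i \<le> g j" "i \<le> g i" "g 0 = 0" "n \<le> i \<Longrightarrow> g i = i" "i \<le> n \<Longrightarrow> g i \<le> n"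
  using assms monoD[of g i n] by (auto simp: ceilings_def dest: monoD)

lemma pmax_ge: "j \<le> i \<Longrightarrow> \<pi> j \<le> pmax \<pi> i"
  by (simp add: pmax_def)

lemma pmax_attained:
  obtains j where "j \<le> i" "pmax \<pi> i = \<pi> j"
proof -
  have "pmax \<pi> i \<in> \<pi> ` {..i}" unfolding pmax_def by (rule Max_in) auto
  then show ?thesis using that by auto
qed

lemma pmax_le_iff: "pmax \<pi> i \<le> v \<longleftrightarrow> (\<forall>j\<le>i. \<pi> j \<le> v)"
  unfolding pmax_def by (subst Max_le_iff) auto

lemma Sym_0: "\<pi> \<in> Sym n \<Longrightarrow> \<pi> 0 = 0"
  by (rule Sym_outside) auto

lemma pmax_in_ceilings:
  assumes S: "\<pi> \<in> Sym n"
  shows "pmax \<pi> \<in> ceilings n"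
proof -
  have low: "i \<le> pmax \<pi> i" for i
  proof -
    have "\<pi> ` {..i} \<subseteq> {..pmax \<pi> i}" using pmax_ge by blast
    then have "card (\<pi> ` {..i}) \<le> card {..pmax \<pi> i}" by (intro card_mono) auto
    moreover have "inj_on \<pi> {..i}" by (simp add: inj_on_def Sym_inj[OF S])
    ultimately show ?thesis by (simp add: card_image)
  qed
  have "pmax \<pi> i \<le> i" if "n \<le> i" for i
    unfolding pmax_le_iff
  proof (intro allI impI)
    fix j assume "j \<le> i"
    then show "\<pi> j \<le> i" using that Sym_bounds[OF S, of j] Sym_outside[OF S, of j]
      by (cases "j \<in> {1..n}") auto
  qed
  moreover have "mono (pmax \<pi>)" by (auto simp: mono_def pmax_le_iff intro: pmax_ge)
  moreover have "pmax \<pi> 0 = 0" by (simp add: pmax_def Sym_0[OF S])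
  ultimately show ?thesis using low by (auto simp: ceilings_def intro: le_antisym)
qed

lemma LMAX_eq_pmax_image:
  assumes S: "\<pi> \<in> Sym n"
  shows "LMAX n \<pi> = pmax \<pi> ` {1..n}"
proof (intro equalityI subsetI)
  fix v assume "v \<in> LMAX n \<pi>"
  then obtain i where i: "v = \<pi> i" "1 \<le> i" "i \<le> n" "\<And>j. j \<in> {1..<i} \<Longrightarrow> \<pi> j < \<pi> i"
    by (auto simp: LMAX_def)
  have "\<pi> j \<le> \<pi> i" if "j \<le> i" for j
    using that i(4)[of j] Sym_0[OF S] by (cases "j = 0 \<or> j = i") auto
  then have "pmax \<pi> i = v" using pmax_le_iff[of \<pi> i v] pmax_ge[of i i \<pi>] i(1) by auto
  then show "v \<in> pmax \<pi> ` {1..n}" using i(2,3) by (intro image_eqI[of _ _ i]) auto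
next
  fix v assume "v \<in> pmax \<pi> ` {1..n}"
  then obtain i where i: "v = pmax \<pi> i" "1 \<le> i" "i \<le> n" by auto
  obtain j where j: "j \<le> i" "pmax \<pi> i = \<pi> j" by (rule pmax_attained)
  have "j \<noteq> 0" using j Sym_0[OF S] ceilingsD(2)[OF pmax_in_ceilings[OF S], of i] i by (cases j) auto
  moreover have "\<pi> l < \<pi> j" if "l < j" for l
    using pmax_ge[of l i \<pi>] that j Sym_inj[OF S, of l j] by auto
  ultimately show "v \<in> LMAX n \<pi>" using i j by (auto simp: LMAX_def intro!: exI[of _ j])
qed

text \<open>Capping \<open>g\<close> at \<open>n\<close> gives a function for \<open>n\<close>. In a permutation for it, place \<open>n + 1\<close> at the first
  position \<open>p\<close> where \<open>g\<close> reaches this value and move the entry from \<open>p\<close> to the end.\<close>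

lemma ex_Sym_pmax:
  assumes "g \<in> ceilings n"
  shows "\<exists>\<pi>\<in>Sym n. pmax \<pi> = g"
  using assms
proof (induction n arbitrary: g)
  case 0
  have "id \<in> Sym 0" by (simp add: Sym_def)
  moreover have "pmax id = g"
    using ceilingsD(4)[OF pmax_in_ceilings[OF \<open>id \<in> Sym 0\<close>]] ceilingsD(4)[OF 0] by auto
  ultimately show ?case by blast
next
  case (Suc n)
  note g = ceilingsD[OF Suc.prems]
  define g' where "g' = (\<lambda>i. if i \<le> n then min (g i) n else i)"
  have "mono g'"
  proof (rule monoI)
    fix x y :: nat assume "x \<le> y"
    then show "g' x \<le> g' y" using g(1)[of x y] by (auto simp: g'_def min_def)
  qed
  then have "g' \<in> ceilings n" using g(2)[of n] g(2,3) by (auto simp: ceilings_def g'_def)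
  then obtain \<rho> where \<rho>: "\<rho> \<in> Sym n" "pmax \<rho> = g'" using Suc.IH by blast
  \<comment> \<open>the position at which the new maximum is inserted\<close>
  define p where "p = (LEAST i. g i = Suc n)"
  have top: "g (Suc n) = Suc n" using g(4) by simp
  then have p: "g p = Suc n" "p \<le> Suc n" unfolding p_def by (auto intro: LeastI Least_le)
  have below_p: "g i \<noteq> Suc n" if "i < p" for i using that not_less_Least unfolding p_def by blast
  have "1 \<le> p" using p(1) g(3) by (cases p) auto
  define \<pi> where "\<pi> = \<rho> \<circ> transpose p (Suc n)"
  have "\<rho> permutes {1..Suc n}" using \<rho>(1) by (auto simp: Sym_def intro: permutes_subset)
  moreover have "transpose p (Suc n) permutes {1..Suc n}"
    using \<open>1 \<le> p\<close> p(2) by (intro permutes_swap_id) auto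
  ultimately have \<pi>: "\<pi> \<in> Sym (Suc n)"
    unfolding \<pi>_def Sym_def by (auto intro: permutes_compose)
  have "pmax \<pi> i = g i" for i
  proof (cases "i < p")
    case True
    have "\<pi> ` {..i} = \<rho> ` {..i}" using True p(2) by (intro image_cong) (auto simp: \<pi>_def transpose_def)
    then have "pmax \<pi> i = g' i" by (simp add: pmax_def flip: \<rho>(2))
    moreover have "g i \<le> n" using g(1)[of i p] True p(1) below_p[OF True] by simp
    ultimately show ?thesis using True p(2) by (simp add: g'_def)
  next
    case False
    show ?thesis
    proof (cases "i \<le> n")
      case True
      have "\<pi> p = Suc n" using Sym_outside[OF \<rho>(1), of "Suc n"] by (simp add: \<pi>_def)
      then have "Suc n \<le> pmax \<pi> i" using pmax_ge[of p i \<pi>] False by simp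
      moreover have "pmax \<pi> i \<le> Suc n" using ceilingsD(5)[OF pmax_in_ceilings[OF \<pi>]] True by simp
      moreover have "g i = Suc n" using g(1)[of p i] g(5)[of i] False True p(1) by simp
      ultimately show ?thesis by simp
    next
      case False
      then show ?thesis using ceilingsD(4)[OF pmax_in_ceilings[OF \<pi>], of i] g(4)[of i] by simp
    qed
  qed
  then show ?case using \<pi> by blast
qed

text \<open>Both entries are hidden behind the larger entry at \<open>i\<close>.\<close>

lemma pmax_swap_below_maximum:
  assumes "i < j" "j < k" "\<pi> j < \<pi> i" "\<pi> k < \<pi> i"
  shows "pmax (\<pi> \<circ> transpose j k) = pmax \<pi>"
proof
  fix l
  have *: "\<exists>y\<le>l. f x \<le> f' y"
    if "x \<le> l" "f j < f i" "f k < f i" "f' = f \<circ> transpose j k" for x f and f' :: "nat \<Rightarrow> nat"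
  proof (cases "x = j \<or> x = k")
    case True
    then have "f x \<le> f' i" "i \<le> l" using that assms(1,2) by auto
    then show ?thesis by blast
  next
    case False
    then have "f x \<le> f' x" using that by simp
    then show ?thesis using that by blast
  qed
  have 1: "\<pi> = (\<pi> \<circ> transpose j k) \<circ> transpose j k" by (simp add: comp_assoc)
  have i: "transpose j k i = i" using assms by simp
  show "pmax (\<pi> \<circ> transpose j k) l = pmax \<pi> l"
    unfolding pmax_def
  proof (rule Max_eq_if)
    show "\<forall>a\<in>(\<pi> \<circ> transpose j k) ` {..l}. \<exists>b\<in>\<pi> ` {..l}. a \<le> b"
      using *[OF _ _ _ 1] assms i by auto
    show "\<forall>a\<in>\<pi> ` {..l}. \<exists>b\<in>(\<pi> \<circ> transpose j k) ` {..l}. a \<le> b"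
      using *[OF _ assms(3,4) refl] by auto
  qed auto
qed

text \<open>Exchanging two entries that form an inversion increases this sum. Hence among the permutations with
  given prefix maxima a maximiser contains no 321 and a minimiser contains no 312: otherwise
  exchanging the last two entries of the pattern would keep the prefix maxima and improve the sum.\<close>

definition weight :: "nat \<Rightarrow> (nat \<Rightarrow> nat) \<Rightarrow> nat" where
  "weight n \<pi> = (\<Sum>i = 1..n. i * \<pi> i)"

lemma weight_swap:
  assumes "1 \<le> j" "j < k" "k \<le> n" "\<pi> k < \<pi> j"
  shows "weight n \<pi> < weight n (\<pi> \<circ> transpose j k)"
proof -
  define A where "A = {1..n} - {j, k}"
  have "{1..n} = insert j (insert k A)" "j \<notin> A" "k \<notin> A" "finite A"
    using assms by (auto simp: A_def)
  then have split: "weight n \<sigma> = j * \<sigma> j + (k * \<sigma> k + (\<Sum>i\<in>A. i * \<sigma> i))" for \<sigma>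
    using assms(2) by (simp add: weight_def)
  have "(\<Sum>i\<in>A. i * \<pi> i) = (\<Sum>i\<in>A. i * (\<pi> \<circ> transpose j k) i)"
    by (intro sum.cong) (auto simp: A_def)
  moreover have "j * \<pi> j + k * \<pi> k < j * \<pi> k + k * \<pi> j"
  proof -
    obtain d where d: "k = Suc (j + d)" using less_imp_Suc_add[OF assms(2)] by auto
    obtain e where e: "\<pi> j = Suc (\<pi> k + e)" using less_imp_Suc_add[OF assms(4)] by auto
    show ?thesis unfolding d[symmetric] by (simp add: e d algebra_simps)
  qed
  ultimately show ?thesis unfolding split by simp
qed

lemma finite_Sym: "finite (Sym n)"
  by (simp add: Sym_def finite_permutations)

lemma Sym_swap: "\<pi> \<in> Sym n \<Longrightarrow> 1 \<le> j \<Longrightarrow> j < k \<Longrightarrow> k \<le> n \<Longrightarrow> \<pi> \<circ> transpose j k \<in> Sym n"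
  unfolding Sym_def by (auto intro!: permutes_compose permutes_swap_id)

text \<open>The permutation is one of maximal weight among those with prefix maxima \<open>g\<close>.\<close>

lemma ex_Av_321_pmax:
  assumes "g \<in> ceilings n"
  shows "\<exists>\<pi>\<in>Av n [3, 2, 1]. pmax \<pi> = g"
proof -
  let ?X = "{\<pi> \<in> Sym n. pmax \<pi> = g}"
  have X: "finite ?X" "?X \<noteq> {}" using finite_Sym ex_Sym_pmax[OF assms] by auto
  then have "Max (weight n ` ?X) \<in> weight n ` ?X" by (intro Max_in) auto
  then obtain \<pi> where \<pi>: "\<pi> \<in> ?X" "weight n \<pi> = Max (weight n ` ?X)" by fastforce
  then have max: "weight n \<rho> \<le> weight n \<pi>" if "\<rho> \<in> ?X" for \<rho>
    unfolding \<pi>(2) using X(1) that by (intro Max_ge) auto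
  have False if ijk: "1 \<le> i" "i < j" "j < k" "k \<le> n" "\<pi> k < \<pi> j" "\<pi> j < \<pi> i" for i j k
  proof -
    have "pmax (\<pi> \<circ> transpose j k) = pmax \<pi>"
      using ijk by (intro pmax_swap_below_maximum[of i]) auto
    then have "\<pi> \<circ> transpose j k \<in> ?X" using Sym_swap[of \<pi> n j k] ijk \<pi>(1) by simp
    then have "weight n (\<pi> \<circ> transpose j k) \<le> weight n \<pi>" by (rule max)
    moreover have "weight n \<pi> < weight n (\<pi> \<circ> transpose j k)"
      using ijk by (intro weight_swap) auto
    ultimately show False by linarith
  qed
  then have "\<pi> \<in> Av n [3, 2, 1]" using \<pi>(1) unfolding in_Av_321 by blast
  then show ?thesis using \<pi>(1) by blast
qed

lemma ex_Av_312_pmax: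
  assumes "g \<in> ceilings n"
  shows "\<exists>\<pi>\<in>Av n [3, 1, 2]. pmax \<pi> = g"
proof -
  let ?X = "{\<pi> \<in> Sym n. pmax \<pi> = g}"
  have X: "finite ?X" "?X \<noteq> {}" using finite_Sym ex_Sym_pmax[OF assms] by auto
  then have "Min (weight n ` ?X) \<in> weight n ` ?X" by (intro Min_in) auto
  then obtain \<pi> where \<pi>: "\<pi> \<in> ?X" "weight n \<pi> = Min (weight n ` ?X)" by fastforce
  then have min: "weight n \<pi> \<le> weight n \<rho>" if "\<rho> \<in> ?X" for \<rho>
    unfolding \<pi>(2) using X(1) that by (intro Min_le) auto
  have False if ijk: "1 \<le> i" "i < j" "j < k" "k \<le> n" "\<pi> j < \<pi> k" "\<pi> k < \<pi> i" for i j k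
  proof -
    let ?\<rho> = "\<pi> \<circ> transpose j k"
    have "pmax ?\<rho> = pmax \<pi>"
      using ijk by (intro pmax_swap_below_maximum[of i]) auto
    then have "?\<rho> \<in> ?X" using Sym_swap[of \<pi> n j k] ijk \<pi>(1) by simp
    then have "weight n \<pi> \<le> weight n ?\<rho>" by (rule min)
    \<comment> \<open>undoing the exchange, an inversion of \<open>?\<rho>\<close>, restores \<open>\<pi>\<close>\<close>
    moreover have "weight n ?\<rho> < weight n (?\<rho> \<circ> transpose j k)"
      using ijk by (intro weight_swap) auto
    then have "weight n ?\<rho> < weight n \<pi>" by (simp add: comp_assoc)
    ultimately show False by linarith
  qed
  then have "\<pi> \<in> Av n [3, 1, 2]" using \<pi>(1) unfolding in_Av_312 by blast
  then show ?thesis using \<pi>(1) by blast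
qed

text \<open>The common prefix maximum \<open>\<pi> m = \<rho> m\<close> at the first difference exceeds both entries there, since
  \<open>m = i\<close> would make the smaller entry a prefix maximum. Each of the two entries reappears further
  right in the other permutation: with \<open>m\<close> and \<open>i\<close> this is 312 in the permutation with the smaller
  entry and 321 in the other one.\<close>

lemma patterns_at_first_difference:
  assumes S: "\<pi> \<in> Sym n" "\<rho> \<in> Sym n" and eq: "pmax \<pi> = pmax \<rho>"
    and agree: "\<And>l. l < i \<Longrightarrow> \<pi> l = \<rho> l" and less: "\<pi> i < \<rho> i"
  shows "\<pi> \<notin> Av n [3, 1, 2]" "\<rho> \<notin> Av n [3, 2, 1]"
proof -
  have i: "1 \<le> i" "i \<le> n"
    using less Sym_outside[OF S(1), of i] Sym_outside[OF S(2), of i] by (cases "i \<in> {1..n}"; auto)+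
  obtain m where m: "m \<le> i" "pmax \<pi> i = \<pi> m" by (rule pmax_attained)
  have ge: "\<rho> i \<le> \<pi> m" using pmax_ge[of i i \<rho>] eq m by simp
  then have "m \<noteq> i" using less by auto
  then have mi: "m < i" "\<pi> m = \<rho> m" using m(1) agree by auto
  then have gt: "\<rho> i < \<pi> m" using ge Sym_inj[OF S(2), of i m] by auto
  then have "1 \<le> m" using Sym_0[OF S(1)] by (cases m) auto
  note b = Sym_bounds[OF S(1) i] Sym_bounds[OF S(2) i]
  obtain l where l: "1 \<le> l" "l \<le> n" "\<pi> l = \<rho> i" using Sym_surj[OF S(1), of "\<rho> i"] b by auto
  have "i < l"
  proof (rule ccontr)
    assume "\<not> i < l"
    then have "l < i" using l less by (cases "l = i") auto
    then show False using agree[of l] l Sym_inj[OF S(2), of l i] by auto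
  qed
  then show "\<pi> \<notin> Av n [3, 1, 2]"
    using Av_312D[of \<pi> n m i l] \<open>1 \<le> m\<close> mi(1) l gt less by auto
  obtain k where k: "1 \<le> k" "k \<le> n" "\<rho> k = \<pi> i" using Sym_surj[OF S(2), of "\<pi> i"] b by auto
  have "i < k"
  proof (rule ccontr)
    assume "\<not> i < k"
    then have "k < i" using k less by (cases "k = i") auto
    then show False using agree[of k] k Sym_inj[OF S(1), of k i] by auto
  qed
  then show "\<rho> \<notin> Av n [3, 2, 1]"
    using Av_321D[of \<rho> n m i k] \<open>1 \<le> m\<close> mi k gt less by auto
qed

lemma inj_on_pmax:
  assumes w: "w = [3, 2, 1] \<or> w = [3, 1, 2]"
  shows "inj_on pmax (Av n w)"
proof (rule inj_onI, rule ccontr)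
  fix \<pi> \<rho> assume A: "\<pi> \<in> Av n w" "\<rho> \<in> Av n w" and eq: "pmax \<pi> = pmax \<rho>" and "\<pi> \<noteq> \<rho>"
  then have ex: "\<exists>i. \<pi> i \<noteq> \<rho> i" by auto
  define i where "i = (LEAST i. \<pi> i \<noteq> \<rho> i)"
  have i: "\<pi> i \<noteq> \<rho> i" "\<And>l. l < i \<Longrightarrow> \<pi> l = \<rho> l"
    using LeastI_ex[OF ex] not_less_Least unfolding i_def by blast+
  note S = A[THEN Av_Sym]
  show False
  proof (cases "\<pi> i < \<rho> i")
    case True
    then show False using patterns_at_first_difference[OF S eq i(2)] A
      by (cases rule: disjE[OF w]) simp_all
  next
    case False
    then have "\<rho> i < \<pi> i" using i(1) by simp
    then show False
      using patterns_at_first_difference[OF S(2,1) eq[symmetric] i(2)[symmetric]] A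
      by (cases rule: disjE[OF w]) simp_all
  qed
qed

lemma bij_betw_pmax:
  assumes w: "w = [3, 2, 1] \<or> w = [3, 1, 2]"
  shows "bij_betw pmax (Av n w) (ceilings n)"
proof -
  have "pmax ` Av n w = ceilings n"
  proof (intro equalityI subsetI)
    show "g \<in> pmax ` Av n w" if "g \<in> ceilings n" for g
      using ex_Av_321_pmax[OF that] ex_Av_312_pmax[OF that] by (cases rule: disjE[OF w]) (metis imageI)+
  qed (use pmax_in_ceilings Av_Sym in blast)
  then show ?thesis using inj_on_pmax[OF w] by (simp add: bij_betw_def)
qed

text \<open>A value that is not a left-to-right maximum has a larger value before it, so an ascent into it would
  complete a 312.\<close>

lemma DESB_Av_312:
  assumes \<pi>: "\<pi> \<in> Av n [3, 1, 2]" and n: "n \<ge> 1"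
  shows "DESB n \<pi> = {1..n} - LMAX n \<pi>"
proof -
  note S = Av_Sym[OF \<pi>]
  have "v \<in> {1..n} - LMAX n \<pi>" if v: "v \<in> DESB n \<pi>" for v
  proof -
    obtain i where i: "v = \<pi> (Suc i)" "1 \<le> i" "i < n" "\<pi> (Suc i) < \<pi> i"
      using v n by (auto simp: DESB_def DES_def)
    have False if "v \<in> LMAX n \<pi>"
    proof -
      obtain j where j: "v = \<pi> j" "\<And>l. l \<in> {1..<j} \<Longrightarrow> \<pi> l < \<pi> j"
        using \<open>v \<in> LMAX n \<pi>\<close> by (auto simp: LMAX_def)
      then have "j = Suc i" using i(1) Sym_inj[OF S, of j "Suc i"] by simp
      then show False using j(2)[of i] i by simp
    qed
    then show ?thesis using i Sym_bounds[OF S, of "Suc i"] by auto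
  qed
  moreover have "v \<in> DESB n \<pi>" if v: "v \<in> {1..n} - LMAX n \<pi>" for v
  proof -
    obtain i where i: "1 \<le> i" "i \<le> n" "\<pi> i = v" using Sym_surj[OF S, of v] v by auto
    have "\<exists>j\<in>{1..<i}. \<not> \<pi> j < \<pi> i"
    proof (rule ccontr)
      assume "\<not> ?thesis"
      then have "v \<in> LMAX n \<pi>" using i by (auto simp: LMAX_def)
      then show False using v by simp
    qed
    then obtain j where j: "1 \<le> j" "j < i" "\<not> \<pi> j < \<pi> i" by auto
    then have ji: "\<pi> i < \<pi> j" using Sym_inj[OF S, of j i] by auto
    obtain l where l: "i = Suc l" using i(1) by (cases i) auto
    have "\<pi> i < \<pi> l"
    proof (rule ccontr)
      assume "\<not> \<pi> i < \<pi> l"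
      then have "\<pi> l < \<pi> i" using Sym_inj[OF S, of l i] l by auto
      moreover from this have "j < l" using j ji l by (cases "j = l") auto
      ultimately show False using Av_312D[OF \<pi> j(1), of l i] ji l i(2) by simp
    qed
    then have "l \<in> DES n \<pi>" using l i(2) j by (auto simp: DES_def)
    then show ?thesis using l i(3) by (auto simp: DESB_def)
  qed
  ultimately show ?thesis by blast
qed

section \<open>Prefix maxima as sequences below a ceiling\<close>

lemma down_closed_eq_interval:
  assumes "X \<subseteq> {1..n::nat}" and down: "\<And>i j. j \<in> X \<Longrightarrow> 1 \<le> i \<Longrightarrow> i \<le> j \<Longrightarrow> i \<in> X"
  shows "X = {1..card X}"
proof (cases "X = {}")
  case False
  have fin: "finite X" using assms(1) finite_subset by blast
  then have "Max X \<in> X" using False by simp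
  then have "X = {1..Max X}" using down Max_ge[OF fin] assms(1) by fastforce
  then show ?thesis by (metis card_atLeastAtMost diff_Suc_1)
qed simp

text \<open>For an increasing \<open>g\<close> this is the last position with \<open>g i \<le> v\<close>, and \<open>0\<close> if there is none; it is the
  \<open>q\<^sub>j\<close> of the introduction for \<open>v = v\<^sub>j\<close>.\<close>

definition last_below :: "nat \<Rightarrow> (nat \<Rightarrow> nat) \<Rightarrow> nat \<Rightarrow> nat" where
  "last_below n g v = card {i \<in> {1..n}. g i \<le> v}"

lemma le_last_below_iff:
  assumes g: "g \<in> ceilings n" and i: "1 \<le> i" "i \<le> n"
  shows "g i \<le> v \<longleftrightarrow> i \<le> last_below n g v"
proof -
  let ?X = "{i \<in> {1..n}. g i \<le> v}"
  have "?X = {1..card ?X}"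
    by (rule down_closed_eq_interval[of _ n]) (auto intro: order_trans[OF ceilingsD(1)[OF g]])
  then have "i \<in> ?X \<longleftrightarrow> i \<in> {1..card ?X}" by blast
  then show ?thesis using i by (auto simp: last_below_def)
qed

lemma last_below_le: "last_below n g v \<le> n"
proof -
  have "card {i \<in> {1..n}. g i \<le> v} \<le> card {1..n}" by (rule card_mono) auto
  then show ?thesis by (simp add: last_below_def)
qed

text \<open>The sequences \<open>u\<close> and \<open>r\<close> of the introduction for the list \<open>vs\<close> of the values of \<open>g\<close>. Lists are indexed
  from 0, so \<open>Suc j\<close> is the rank of \<open>vs ! j\<close>; the truncated subtractions are exact because both
  minuends are at least \<open>Suc j\<close>. The last value is left out: it is \<open>n\<close>, where \<open>g\<close> has no freedom.\<close>

definition bound :: "nat list \<Rightarrow> nat list" where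
  "bound vs = map (\<lambda>j. vs ! j - Suc j) [0..<length vs - 1]"

definition path :: "nat \<Rightarrow> nat list \<Rightarrow> (nat \<Rightarrow> nat) \<Rightarrow> nat list" where
  "path n vs g = map (\<lambda>j. last_below n g (vs ! j) - Suc j) [0..<length vs - 1]"

context
  fixes n :: nat and vs :: "nat list"
  assumes n: "n \<ge> 1" and vs: "sorted_wrt (<) vs" "set vs \<subseteq> {1..n}" "n \<in> set vs"
begin

lemma vs_less: "i < j \<Longrightarrow> j < length vs \<Longrightarrow> vs ! i < vs ! j"
  using vs(1) by (simp add: sorted_wrt_iff_nth_less)

lemma vs_le: "i \<le> j \<Longrightarrow> j < length vs \<Longrightarrow> vs ! i \<le> vs ! j"
  using vs_less[of i j] by (cases "i = j") auto

lemma vs_range: "j < length vs \<Longrightarrow> 1 \<le> vs ! j \<and> vs ! j \<le> n"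
  using vs(2) nth_mem by fastforce

lemma length_vs: "1 \<le> length vs"
  using vs(3) by (cases vs) auto

lemma vs_last: "vs ! (length vs - 1) = n"
proof -
  obtain j where j: "j < length vs" "vs ! j = n" using vs(3) by (auto simp: in_set_conv_nth)
  moreover have "j \<le> length vs - 1" "length vs - 1 < length vs" using j(1) by auto
  ultimately show ?thesis using vs_le[of j "length vs - 1"] vs_range[of "length vs - 1"] by simp
qed

lemma vs_less_n: "j < length vs - 1 \<Longrightarrow> vs ! j < n"
  using vs_less[of j "length vs - 1"] vs_last by auto

lemma Suc_le_vs: "j < length vs \<Longrightarrow> Suc j \<le> vs ! j"
proof (induction j)
  case 0
  then show ?case using vs_range[of 0] by simp
next
  case (Suc j)
  then show ?case using vs_less[of j "Suc j"] by simp
qed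

lemma sorted_bound: "sorted (bound vs)"
proof -
  have "vs ! j - Suc j \<le> vs ! Suc j - Suc (Suc j)" if "Suc j < length vs - 1" for j
  proof -
    have "Suc j < length vs" using that by simp
    then show ?thesis using vs_less[of j "Suc j"] by simp
  qed
  then show ?thesis by (simp add: sorted_iff_nth_Suc bound_def)
qed

context
  fixes g :: "nat \<Rightarrow> nat"
  assumes g: "g \<in> ceilings n" and img: "g ` {1..n} = set vs"
begin

abbreviation q :: "nat \<Rightarrow> nat" where
  "q j \<equiv> last_below n g (vs ! j)"

lemma q_iff: "1 \<le> i \<Longrightarrow> i \<le> n \<Longrightarrow> g i \<le> vs ! j \<longleftrightarrow> i \<le> q j"
  by (rule le_last_below_iff[OF g])

lemma value_attained:
  assumes "j < length vs"
  obtains i where "1 \<le> i" "i \<le> n" "g i = vs ! j"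
proof -
  have "vs ! j \<in> g ` {1..n}" using assms img by simp
  then show ?thesis using that by auto
qed

lemma ceiling_is_value:
  assumes "1 \<le> i" "i \<le> n"
  obtains j where "j < length vs" "g i = vs ! j"
proof -
  have "g i \<in> set vs" using assms img by auto
  then show ?thesis using that by (auto simp: in_set_conv_nth)
qed

lemma q_le: "j < length vs \<Longrightarrow> q j \<le> vs ! j"
proof (cases "q j = 0")
  case False
  then have "g (q j) \<le> vs ! j" using q_iff[of "q j" j] last_below_le[of n g "vs ! j"] by simp
  then show ?thesis using ceilingsD(2)[OF g, of "q j"] by simp
qed simp

lemma q_less:
  assumes "i < j" "j < length vs" shows "q i < q j"
proof -
  obtain p where p: "1 \<le> p" "p \<le> n" "g p = vs ! j" using value_attained assms by blast
  then have "p \<le> q j" "\<not> p \<le> q i" using q_iff[of p j] q_iff[of p i] vs_less[OF assms] by auto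
  then show ?thesis by simp
qed

lemma q_last: "q (length vs - 1) = n"
  using q_iff[of n "length vs - 1"] ceilingsD(4)[OF g, of n] n vs_last
    last_below_le[of n g "vs ! (length vs - 1)"] by auto

lemma Suc_le_q: "j < length vs \<Longrightarrow> Suc j \<le> q j"
proof (induction j)
  case 0
  obtain p where "1 \<le> p" "p \<le> n" "g p = vs ! 0" using value_attained[OF 0] by blast
  then show ?case using q_iff[of p 0] by simp
next
  case (Suc j)
  then show ?case using q_less[of j "Suc j"] by simp
qed

lemma path_weakly_below: "path n vs g \<in> weakly_below (bound vs)"
proof -
  have "q j - Suc j \<le> q (Suc j) - Suc (Suc j)" if "Suc j < length vs - 1" for j
  proof -
    have "Suc j < length vs" using that by simp
    then show ?thesis using q_less[of j "Suc j"] by simp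
  qed
  then have "sorted (path n vs g)" by (simp add: sorted_iff_nth_Suc path_def)
  moreover have "list_all2 (\<le>) (path n vs g) (bound vs)"
    using q_le by (auto simp: list_all2_conv_all_nth path_def bound_def intro: diff_le_mono)
  ultimately show ?thesis by (simp add: weakly_below_def)
qed

lemma zeros_path: "zeros (path n vs g) = card {j. j < length vs - 1 \<and> q j = Suc j}"
proof -
  have "{j. j < length (path n vs g) \<and> path n vs g ! j = 0} = {j. j < length vs - 1 \<and> q j = Suc j}"
    using Suc_le_q by (auto simp: path_def intro: le_antisym)
  then show ?thesis by (simp add: zeros_def length_filter_conv_card)
qed

lemma contacts_path:
  "contacts (bound vs) (path n vs g) = card {j. j < length vs - 1 \<and> q j = vs ! j}"
proof -
  have "q j - Suc j = vs ! j - Suc j \<longleftrightarrow> q j = vs ! j" if "j < length vs - 1" for j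
  proof -
    have "j < length vs" using that by simp
    then show ?thesis using Suc_le_q[of j] Suc_le_vs[of j] by auto
  qed
  then have "{j. j < length (zip (path n vs g) (bound vs)) \<and>
      (case zip (path n vs g) (bound vs) ! j of (x, y) \<Rightarrow> x = y)} =
    {j. j < length vs - 1 \<and> q j = vs ! j}"
    by (auto simp: path_def bound_def) metis
  then show ?thesis by (simp add: contacts_def length_filter_conv_card)
qed

text \<open>A fixed point of \<open>g\<close> is one of its values \<open>vs ! j\<close>, and \<open>g\<close> fixes this value if and only if the last
  position with \<open>g i \<le> vs ! j\<close> is as far right as possible. The fixed point \<open>n\<close> accounts for the successor.\<close>

lemma card_fixed_points_eq_contacts:
  "card {i \<in> {1..n}. g i = i} = Suc (contacts (bound vs) (path n vs g))"
proof -
  let ?J = "{j. j < length vs - 1 \<and> q j = vs ! j}"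
  have fixed: "g (vs ! j) = vs ! j \<longleftrightarrow> q j = vs ! j" if "j < length vs" for j
    using q_iff[of "vs ! j" j] vs_range[OF that] q_le[OF that] ceilingsD(2)[OF g, of "vs ! j"]
    by auto
  have "{i \<in> {1..n}. g i = i} = (!) vs ` {j. j < length vs \<and> q j = vs ! j}"
  proof (intro equalityI subsetI)
    fix i assume i: "i \<in> {i \<in> {1..n}. g i = i}"
    then obtain j where "j < length vs" "g i = vs ! j" using ceiling_is_value[of i] by auto
    then show "i \<in> (!) vs ` {j. j < length vs \<and> q j = vs ! j}" using fixed[of j] i by auto
  next
    fix i assume "i \<in> (!) vs ` {j. j < length vs \<and> q j = vs ! j}"
    then show "i \<in> {i \<in> {1..n}. g i = i}" using fixed vs_range by auto
  qed
  moreover have "inj_on ((!) vs) {j. j < length vs \<and> q j = vs ! j}"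
    using vs(1) by (auto simp: strict_sorted_iff inj_on_def nth_eq_iff_index_eq)
  moreover have "{j. j < length vs \<and> q j = vs ! j} = insert (length vs - 1) ?J"
    using length_vs vs_last q_last by auto
  ultimately show ?thesis by (simp add: card_image contacts_path)
qed

lemma comps_eq_contacts:
  assumes "\<pi> \<in> Sym n" "pmax \<pi> = g"
  shows "comps n \<pi> = Suc (contacts (bound vs) (path n vs g))"
proof -
  have "(\<forall>j \<in> {1..i}. \<pi> j \<le> i) \<longleftrightarrow> g i = i" for i
  proof -
    have "(\<forall>j \<in> {1..i}. \<pi> j \<le> i) \<longleftrightarrow> pmax \<pi> i \<le> i"
      unfolding pmax_le_iff
    proof (intro iffI ballI allI impI)
      fix j assume *: "\<forall>j \<in> {1..i}. \<pi> j \<le> i" "j \<le> i"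
      then show "\<pi> j \<le> i" using Sym_0[OF assms(1)] by (cases "j = 0") auto
    qed auto
    then show ?thesis using ceilingsD(2)[OF g, of i] assms(2) by auto
  qed
  then have "comps n \<pi> = card {i \<in> {1..n}. g i = i}" by (simp add: comps_def)
  then show ?thesis using card_fixed_points_eq_contacts by simp
qed

text \<open>Since \<open>q\<close> is strictly increasing, the indices with \<open>q j = Suc j\<close> form an initial segment, of some length
  \<open>m\<close>. There \<open>g\<close> takes a new value at each position, so the permutation ascends; right
  after it, positions \<open>m + 1\<close> and \<open>m + 2\<close> share their prefix maximum, which makes \<open>m + 1\<close> a
  descent, unless \<open>m + 1 = n\<close>.\<close>

lemma iar_eq_zeros:
  assumes \<pi>: "\<pi> \<in> Sym n" "pmax \<pi> = g"
  shows "iar n \<pi> = Suc (zeros (path n vs g))"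
proof -
  let ?J = "{j. j < length vs - 1 \<and> q j = Suc j}"
  define m where "m = card ?J"
  have "Suc ` ?J = {1..card (Suc ` ?J)}"
  proof (rule down_closed_eq_interval[of _ "length vs - 1"])
    fix i j assume "j \<in> Suc ` ?J" "1 \<le> i" "i \<le> j"
    then obtain l k where l: "i = Suc l" "j = Suc k" "l \<le> k" "k < length vs - 1" "q k = Suc k"
      by (cases i) auto
    have "q (k - d) \<le> Suc (k - d)" for d
    proof (induction d)
      case (Suc d)
      show ?case
      proof (cases "d < k")
        case True
        then have "q (k - Suc d) < q (k - d)" using l(4) by (intro q_less) auto
        then show ?thesis using Suc True by simp
      qed (use Suc in simp)
    qed (use l in simp)
    from this[of "k - l"] have "q l = Suc l" using Suc_le_q[of l] l by simp
    then show "i \<in> Suc ` ?J" using l by auto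
  qed auto
  then have J: "Suc ` ?J = {1..m}" by (simp add: card_image m_def)
  have Jiff: "j < m \<longleftrightarrow> j < length vs - 1 \<and> q j = Suc j" for j
  proof -
    have "j < m \<longleftrightarrow> Suc j \<in> Suc ` ?J" unfolding J by auto
    then show ?thesis by auto
  qed
  have m_le: "m \<le> length vs - 1" using Jiff[of "m - 1"] by (cases m) auto
  have ge: "vs ! m \<le> g (Suc m)" if "Suc m \<le> n"
  proof -
    obtain j where j: "j < length vs" "g (Suc m) = vs ! j" using ceiling_is_value[of "Suc m"] \<open>Suc m \<le> n\<close> by auto
    have "m \<le> j"
    proof (rule ccontr)
      assume "\<not> m \<le> j"
      then have "q j = Suc j" "Suc j \<le> m" using Jiff[of j] by auto
      then show False using q_iff[of "Suc m" j] j \<open>Suc m \<le> n\<close> by simp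
    qed
    then show ?thesis using vs_le j by simp
  qed
  \<comment> \<open>a new prefix maximum at \<open>i + 1\<close> must be the entry there\<close>
  have asc: "\<pi> i < \<pi> (Suc i)" if "1 \<le> i" "i \<le> m" for i
  proof -
    obtain j where j: "i = Suc j" using \<open>1 \<le> i\<close> by (cases i) auto
    then have q: "j < length vs - 1" "q j = i" using Jiff[of j] \<open>i \<le> m\<close> by auto
    have "j < length vs" using q(1) by simp
    then have "i < n" using q_le[of j] vs_less_n[OF q(1)] q(2) by simp
    then have "g i \<le> vs ! j" "vs ! j < g (Suc i)"
      using q_iff[of i j] q_iff[of "Suc i" j] q \<open>1 \<le> i\<close> by auto
    then have "pmax \<pi> i < pmax \<pi> (Suc i)" using \<pi>(2) by simp
    moreover obtain l where "l \<le> Suc i" "pmax \<pi> (Suc i) = \<pi> l" by (rule pmax_attained)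
    moreover have "l = Suc i"
      using calculation pmax_ge[of l i \<pi>] by (cases "l \<le> i") auto
    ultimately show ?thesis using pmax_ge[of i i \<pi>] by simp
  qed
  have mlen: "m < length vs" using m_le length_vs by simp
  have Sucm: "Suc m \<le> n" using Suc_le_vs[OF mlen] vs_range[OF mlen] by simp
  have desc: "\<pi> (Suc (Suc m)) < \<pi> (Suc m)" if "Suc m < n"
  proof -
    have "q m \<noteq> Suc m"
    proof (cases "m < length vs - 1")
      case True
      then show ?thesis using Jiff[of m] by simp
    next
      case False
      then have "m = length vs - 1" using m_le by simp
      then show ?thesis using q_last that by simp
    qed
    then have "Suc (Suc m) \<le> q m" using Suc_le_q[OF mlen] by simp
    then have "g (Suc (Suc m)) \<le> vs ! m" using q_iff[of "Suc (Suc m)" m] that by simp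
    then have flat: "g (Suc (Suc m)) \<le> g (Suc m)" using ge[OF Sucm] by simp
    \<comment> \<open>the first \<open>m + 1\<close> entries ascend, so the last of them is their maximum\<close>
    have "\<pi> (Suc m) = pmax \<pi> (Suc m)"
    proof -
      have up: "\<pi> l \<le> \<pi> (Suc l)" if "l \<le> m" for l
        using asc[of l] that Sym_0[OF \<pi>(1)] by (cases "l = 0") auto
      have "\<pi> (Suc m - d) \<le> \<pi> (Suc m)" for d
      proof (induction d)
        case (Suc d)
        show ?case
        proof (cases "d < Suc m")
          case True
          then have "Suc (m - d) = Suc m - d" by simp
          then show ?thesis using up[of "m - d"] Suc by simp
        qed (use Suc in simp)
      qed simp
      then have "\<pi> l \<le> \<pi> (Suc m)" if "l \<le> Suc m" for l
        using that diff_diff_cancel[OF that] by metis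
      then have "pmax \<pi> (Suc m) \<le> \<pi> (Suc m)" unfolding pmax_le_iff by blast
      then show ?thesis using pmax_ge[of "Suc m" "Suc m" \<pi>] by simp
    qed
    then have "\<pi> (Suc (Suc m)) \<le> \<pi> (Suc m)"
      using flat pmax_ge[of "Suc (Suc m)" "Suc (Suc m)" \<pi>] \<pi>(2) by simp
    then show ?thesis using Sym_inj[OF \<pi>(1), of "Suc (Suc m)" "Suc m"] by simp
  qed
  have "Min (DES n \<pi> \<union> {n}) = Suc m"
  proof (rule Min_eqI)
    show "Suc m \<in> DES n \<pi> \<union> {n}" using desc Sucm by (auto simp: DES_def)
    show "Suc m \<le> i" if "i \<in> DES n \<pi> \<union> {n}" for i
    proof (rule ccontr)
      assume lt: "\<not> Suc m \<le> i"
      then have "i \<in> DES n \<pi>" using that Sucm by auto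
      then show False using asc[of i] lt by (auto simp: DES_def)
    qed
  qed (simp add: finite_DES)
  then show ?thesis by (simp add: iar_def zeros_path m_def)
qed

end

lemma inj_on_path: "inj_on (path n vs) {g \<in> ceilings n. g ` {1..n} = set vs}"
proof (rule inj_onI)
  fix g g' assume G: "g \<in> {g \<in> ceilings n. g ` {1..n} = set vs}" "g' \<in> {g \<in> ceilings n. g ` {1..n} = set vs}"
    and eq: "path n vs g = path n vs g'"
  then have g: "g \<in> ceilings n" "g ` {1..n} = set vs" and g': "g' \<in> ceilings n" "g' ` {1..n} = set vs"
    by auto
  have q: "last_below n g (vs ! j) = last_below n g' (vs ! j)" if "j < length vs" for j
  proof (cases "j < length vs - 1")
    case True
    then have "path n vs g ! j = path n vs g' ! j" using eq by simp
    then show ?thesis using True Suc_le_q[OF g, of j] Suc_le_q[OF g', of j] that by (simp add: path_def)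
  next
    case False
    then have "j = length vs - 1" using that by simp
    then show ?thesis using q_last[OF g] q_last[OF g'] by simp
  qed
  have "g i = g' i" for i
  proof (cases "i \<in> {1..n}")
    case True
    then have i: "1 \<le> i" "i \<le> n" by auto
    have iff: "g i \<le> vs ! j \<longleftrightarrow> g' i \<le> vs ! j" if "j < length vs" for j
      using q_iff[OF g i, of j] q_iff[OF g' i, of j] q[OF that] by simp
    obtain j where "j < length vs" "g i = vs ! j" using ceiling_is_value[OF g i] .
    moreover obtain j' where "j' < length vs" "g' i = vs ! j'" using ceiling_is_value[OF g' i] .
    ultimately show ?thesis using iff[of j] iff[of j'] by simp
  next
    case False
    then consider "i = 0" | "n \<le> i" by fastforce
    then show ?thesis
      by cases (use ceilingsD(3,4)[OF g(1)] ceilingsD(3,4)[OF g'(1)] in auto)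
  qed
  then show "g = g'" by auto
qed

text \<open>With \<open>t j = r ! j + Suc j\<close> in the role of \<open>q\<close>, the value at position \<open>i\<close> has to be the first \<open>vs ! j\<close> with
  \<open>i \<le> t j\<close>. Its index is the number \<open>c i\<close> of those \<open>t j\<close> that are less than \<open>i\<close>.\<close>

lemma ex_ceiling_path:
  assumes r: "r \<in> weakly_below (bound vs)"
  shows "\<exists>g\<in>ceilings n. g ` {1..n} = set vs \<and> path n vs g = r"
proof -
  let ?k = "length vs - 1"
  have len: "length r = ?k" and sorted: "sorted r" and le: "\<And>j. j < ?k \<Longrightarrow> r ! j \<le> vs ! j - Suc j"
    using r by (auto simp: weakly_below_def bound_def list_all2_conv_all_nth)
  define t where "t j = r ! j + Suc j" for j
  have t_le: "t j \<le> vs ! j" if "j < ?k" for j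
  proof -
    have "j < length vs" using that by simp
    then show ?thesis using le[OF that] Suc_le_vs[of j] by (simp add: t_def)
  qed
  have t_less: "t i < t j \<longleftrightarrow> i < j" if "i < ?k" "j < ?k" for i j
  proof -
    have "t i < t j" if "i < j" "j < ?k" for i j
      using sorted_nth_mono[OF sorted, of i j] that len by (simp add: t_def)
    then show ?thesis using that by (metis less_asym' linorder_neqE_nat less_irrefl)
  qed
  define c where "c i = card {j. j < ?k \<and> t j < i}" for i
  have c_iff: "j < c i \<longleftrightarrow> t j < i" if j: "j < ?k" for i j
  proof -
    let ?X = "{j. j < ?k \<and> t j < i}"
    have "Suc ` ?X = {1..card (Suc ` ?X)}"
    proof (rule down_closed_eq_interval[of _ ?k])
      fix a b assume "b \<in> Suc ` ?X" "1 \<le> a" "a \<le> b"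
      then obtain a' b' where ab: "a = Suc a'" "b = Suc b'" "a' \<le> b'" "b' < ?k" "t b' < i"
        by (cases a) auto
      then have "t a' \<le> t b'" using t_less[of b' a'] by auto
      then show "a \<in> Suc ` ?X" using ab by auto
    qed auto
    then have X: "Suc ` ?X = {1..c i}" by (simp add: card_image c_def)
    have "j < c i \<longleftrightarrow> Suc j \<in> Suc ` ?X" unfolding X by auto
    then show ?thesis using j by auto
  qed
  have c_le: "c i \<le> ?k" for i
  proof -
    have "card {j. j < ?k \<and> t j < i} \<le> card {..<?k}" by (rule card_mono) auto
    then show ?thesis by (simp add: c_def)
  qed
  have c_mono: "c i \<le> c j" if "i \<le> j" for i j
    unfolding c_def using that by (intro card_mono) auto
  have c_lt: "c i < length vs" for i using c_le[of i] length_vs by simp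
  define g where "g i = (if i = 0 then 0 else if i \<le> n then vs ! c i else i)" for i
  have i_le: "i \<le> vs ! c i" if "i \<le> n" for i
  proof (cases "c i < ?k")
    case True
    then show ?thesis using c_iff[of "c i" i] t_le[of "c i"] by simp
  next
    case False
    then have "c i = ?k" using c_le[of i] by simp
    then show ?thesis using vs_last that by simp
  qed
  have gn: "g n = n"
    using i_le[of n] vs_range[OF c_lt[of n]] n by (simp add: g_def)
  have "mono g"
  proof (rule monoI)
    fix x y :: nat assume xy: "x \<le> y"
    consider "x = 0" | "1 \<le> x" "y \<le> n" | "x \<le> n" "n < y" "1 \<le> x" | "n < x" using xy by linarith
    then show "g x \<le> g y"
    proof cases
      case 2
      then show ?thesis using xy vs_le[OF c_mono[OF xy] c_lt] by (simp add: g_def)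
    next
      case 3
      then show ?thesis using vs_range[OF c_lt[of x]] by (simp add: g_def)
    qed (use xy in \<open>auto simp: g_def\<close>)
  qed
  moreover have "i \<le> g i" for i using i_le[of i] by (simp add: g_def)
  moreover have "g i = i" if "n \<le> i" for i using gn that by (cases "i = n") (auto simp: g_def)
  ultimately have G: "g \<in> ceilings n" by (simp add: ceilings_def g_def)
  have img: "g ` {1..n} = set vs"
  proof (intro equalityI subsetI)
    fix v assume "v \<in> g ` {1..n}"
    then show "v \<in> set vs" using c_lt by (auto simp: g_def)
  next
    fix v assume "v \<in> set vs"
    then obtain j where j: "j < length vs" "v = vs ! j" by (auto simp: in_set_conv_nth)
    show "v \<in> g ` {1..n}"
    proof (cases "j < ?k")
      case True
      have "{j'. j' < ?k \<and> t j' < t j} = {..<j}" using t_less True by auto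
      then have "c (t j) = j" by (simp add: c_def)
      moreover have "1 \<le> t j" "t j \<le> n" using t_le[OF True] vs_range[OF j(1)] by (auto simp: t_def)
      ultimately show ?thesis using j(2) by (intro image_eqI[of _ _ "t j"]) (auto simp: g_def)
    next
      case False
      then have "j = ?k" using j(1) by simp
      then show ?thesis using gn vs_last j(2) n by (intro image_eqI[of _ _ n]) auto
    qed
  qed
  have "path n vs g = r"
  proof (rule nth_equalityI)
    show "length (path n vs g) = length r" by (simp add: path_def len)
    fix j assume "j < length (path n vs g)"
    then have j: "j < ?k" by (simp add: path_def)
    have "g i \<le> vs ! j \<longleftrightarrow> i \<le> t j" if "i \<in> {1..n}" for i
    proof -
      have "g i \<le> vs ! j \<longleftrightarrow> c i \<le> j"
      proof (cases "c i \<le> j")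
        case True
        then show ?thesis using that vs_le[of "c i" j] j by (simp add: g_def)
      next
        case False
        then show ?thesis using that vs_less[of j "c i"] c_lt[of i] by (simp add: g_def)
      qed
      also have "\<dots> \<longleftrightarrow> i \<le> t j" using c_iff[OF j, of i] by auto
      finally show ?thesis .
    qed
    then have "{i \<in> {1..n}. g i \<le> vs ! j} = {i \<in> {1..n}. i \<le> t j}" by blast
    moreover have "t j \<le> n" using t_le[OF j] vs_less_n[OF j] by simp
    then have "{i \<in> {1..n}. i \<le> t j} = {1..t j}" by auto
    ultimately have "last_below n g (vs ! j) = t j" by (simp add: last_below_def)
    then show "path n vs g ! j = r ! j" using j by (simp add: path_def t_def)
  qed
  then show ?thesis using G img by blast
qed

end

lemma card_bij_betw_Collect:
  assumes "bij_betw h A B" and "\<And>x. x \<in> A \<Longrightarrow> P x \<longleftrightarrow> Q (h x)"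
  shows "card {x \<in> A. P x} = card {y \<in> B. Q y}"
proof -
  have "h ` {x \<in> A. P x} = {y \<in> B. Q y}"
    using assms by (auto simp: bij_betw_def)
  moreover have "inj_on h {x \<in> A. P x}"
    using assms(1) by (auto simp: bij_betw_def intro: inj_on_subset)
  ultimately show ?thesis using card_image[of h "{x \<in> A. P x}"] by simp
qed

text \<open>All three statistics of a permutation can be read off its prefix maxima, so the result holds for any
  set of permutations that the prefix maxima parametrise.\<close>

lemma jointly_symmetric_if_bij_betw_pmax:
  assumes n: "n \<ge> 1" and S: "S \<subseteq> Sym n" and bij: "bij_betw pmax S (ceilings n)"
  shows "jointly_symmetric S (LMAX n) (iar n) (comps n)"
  unfolding jointly_symmetric_def
proof (intro allI)
  fix V a b
  let ?A = "{\<pi> \<in> S. LMAX n \<pi> = V}"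
  show "card {\<pi> \<in> S. LMAX n \<pi> = V \<and> iar n \<pi> = a \<and> comps n \<pi> = b} =
    card {\<pi> \<in> S. LMAX n \<pi> = V \<and> iar n \<pi> = b \<and> comps n \<pi> = a}"
  proof (cases "?A = {}")
    case True
    then have "{\<pi> \<in> S. LMAX n \<pi> = V \<and> iar n \<pi> = x \<and> comps n \<pi> = y} = {}" for x y by blast
    then show ?thesis by (simp only:)
  next
    case False
    then obtain \<pi>0 where \<pi>0: "\<pi>0 \<in> Sym n" "LMAX n \<pi>0 = V" using S by blast
    have V: "V = pmax \<pi>0 ` {1..n}" using LMAX_eq_pmax_image[OF \<pi>0(1)] \<pi>0(2) by simp
    define vs where "vs = sorted_list_of_set V"
    have set: "set vs = V" using V by (simp add: vs_def)
    note c = ceilingsD[OF pmax_in_ceilings[OF \<pi>0(1)]]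
    have sub: "set vs \<subseteq> {1..n}"
    proof
      fix v assume "v \<in> set vs"
      then obtain i where "1 \<le> i" "i \<le> n" "v = pmax \<pi>0 i" using V set by auto
      then show "v \<in> {1..n}" using c(2)[of i] c(5)[of i] by simp
    qed
    have "n \<in> set vs" unfolding set V using n c(4)[of n] by (intro image_eqI[of _ _ n]) auto
    moreover have "sorted_wrt (<) vs" by (simp add: vs_def)
    ultimately have vs: "sorted_wrt (<) vs" "set vs \<subseteq> {1..n}" "n \<in> set vs" using sub by auto
    let ?G = "{g \<in> ceilings n. g ` {1..n} = set vs}"
    have LMAX: "LMAX n \<pi> = pmax \<pi> ` {1..n}" if "\<pi> \<in> S" for \<pi>
      using that S LMAX_eq_pmax_image by blast
    have "pmax ` ?A = ?G"
    proof (intro equalityI subsetI)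
      fix g assume "g \<in> pmax ` ?A"
      then show "g \<in> ?G" using bij LMAX set by (auto simp: bij_betw_def)
    next
      fix g assume g: "g \<in> ?G"
      then obtain \<pi> where "\<pi> \<in> S" "g = pmax \<pi>" using bij unfolding bij_betw_def by blast
      then show "g \<in> pmax ` ?A" using g LMAX set by auto
    qed
    then have "bij_betw pmax ?A ?G"
      using bij by (auto simp: bij_betw_def intro: inj_on_subset)
    moreover have "bij_betw (path n vs) ?G (weakly_below (bound vs))"
      unfolding bij_betw_def
    proof (intro conjI equalityI subsetI)
      show "r \<in> weakly_below (bound vs)" if "r \<in> path n vs ` ?G" for r
        using that path_weakly_below[OF n vs] by blast
      show "r \<in> path n vs ` ?G" if "r \<in> weakly_below (bound vs)" for r
        using ex_ceiling_path[OF n vs that] by blast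
    qed (rule inj_on_path[OF n vs])
    ultimately have h: "bij_betw (path n vs \<circ> pmax) ?A (weakly_below (bound vs))"
      by (rule bij_betw_trans)
    have count: "card {\<pi> \<in> S. LMAX n \<pi> = V \<and> iar n \<pi> = x \<and> comps n \<pi> = y} =
      card {r \<in> weakly_below (bound vs). Suc (zeros r) = x \<and> Suc (contacts (bound vs) r) = y}" for x y
    proof -
      have "iar n \<pi> = Suc (zeros ((path n vs \<circ> pmax) \<pi>)) \<and>
          comps n \<pi> = Suc (contacts (bound vs) ((path n vs \<circ> pmax) \<pi>))" if "\<pi> \<in> ?A" for \<pi>
      proof -
        have \<pi>: "\<pi> \<in> Sym n" using that S by blast
        have "pmax \<pi> ` {1..n} = set vs" using that LMAX_eq_pmax_image[OF \<pi>] set by simp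
        note g = pmax_in_ceilings[OF \<pi>] this
        show ?thesis
          using iar_eq_zeros[OF n vs g \<pi> refl] comps_eq_contacts[OF n vs g \<pi> refl] by simp
      qed
      then have "card {\<pi> \<in> ?A. iar n \<pi> = x \<and> comps n \<pi> = y} =
        card {r \<in> weakly_below (bound vs). Suc (zeros r) = x \<and> Suc (contacts (bound vs) r) = y}"
        by (intro card_bij_betw_Collect[OF h]) auto
      then show ?thesis by (simp add: conj_assoc)
    qed
    show ?thesis unfolding count
    proof (cases "a = 0 \<or> b = 0")
      case True
      then show "card {r \<in> weakly_below (bound vs). Suc (zeros r) = a \<and> Suc (contacts (bound vs) r) = b} =
        card {r \<in> weakly_below (bound vs). Suc (zeros r) = b \<and> Suc (contacts (bound vs) r) = a}"
        by auto
    next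
      case False
      then obtain a' b' where "a = Suc a'" "b = Suc b'" by (cases a; cases b) auto
      then show "card {r \<in> weakly_below (bound vs). Suc (zeros r) = a \<and> Suc (contacts (bound vs) r) = b} =
        card {r \<in> weakly_below (bound vs). Suc (zeros r) = b \<and> Suc (contacts (bound vs) r) = a}"
        using card_zeros_contacts_symmetric[OF sorted_bound[OF n vs], of a' b'] by simp
    qed
  qed
qed

section \<open>Sliding 132-avoiding permutations\<close>

definition lift_above :: "nat \<Rightarrow> nat \<Rightarrow> nat" where
  "lift_above w x = (if x < w then x else Suc x)"

lemma lift_above_less_iff [simp]: "lift_above w x < lift_above w y \<longleftrightarrow> x < y"
  by (auto simp: lift_above_def)

lemma lift_above_neq [simp]: "lift_above w x \<noteq> w" "w \<noteq> lift_above w x"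
  by (auto simp: lift_above_def)

text \<open>The permutation \<open>\<rho>\<close> arises from \<open>\<pi>\<close> by removing the first entry \<open>\<pi> 1\<close>, lowering the larger entries by 1
  and appending \<open>n\<close>. A relation is used instead of a function because both directions of the bijection
  are needed, and the invariants are then proved once. The condition \<open>\<rho> 1 = \<pi> 1\<close> says that
  \<open>\<pi> 2 = \<pi> 1 + 1\<close>, so that the new first entry is the old one.\<close>

definition slides_to :: "nat \<Rightarrow> (nat \<Rightarrow> nat) \<Rightarrow> (nat \<Rightarrow> nat) \<Rightarrow> bool" where
  "slides_to n \<pi> \<rho> \<longleftrightarrow> \<pi> \<in> Sym n \<and> \<rho> \<in> Sym n \<and> n \<ge> 2 \<and> \<rho> 1 = \<pi> 1 \<and> \<rho> n = n \<and>
     (\<forall>i \<in> {1..<n}. \<pi> (Suc i) = lift_above (\<pi> 1) (\<rho> i))"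

context
  fixes n :: nat and \<pi> \<rho> :: "nat \<Rightarrow> nat"
  assumes sl: "slides_to n \<pi> \<rho>"
begin

lemma slides_to_Suc: "1 \<le> i \<Longrightarrow> i < n \<Longrightarrow> \<pi> (Suc i) = lift_above (\<pi> 1) (\<rho> i)"
  using sl by (auto simp: slides_to_def)

lemma slides_to_basic:
  "\<pi> \<in> Sym n" "\<rho> \<in> Sym n" "n \<ge> 2" "\<rho> 1 = \<pi> 1" "\<rho> n = n" "\<pi> 2 = Suc (\<pi> 1)"
  using sl slides_to_Suc[of 1] by (auto simp: slides_to_def lift_above_def numeral_2_eq_2)

lemma slides_to_less_iff:
  "1 \<le> i \<Longrightarrow> i < n \<Longrightarrow> 1 \<le> j \<Longrightarrow> j < n \<Longrightarrow> \<pi> (Suc i) < \<pi> (Suc j) \<longleftrightarrow> \<rho> i < \<rho> j"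
  by (simp add: slides_to_Suc)

text \<open>The appended maximum cannot end a 132. A 132 that starts with the removed entry \<open>\<pi> 1\<close> can start with
  \<open>\<pi> 2 = \<pi> 1 + 1\<close> instead.\<close>

lemma slides_to_avoids_132: "\<pi> \<in> Av n [1, 3, 2] \<longleftrightarrow> \<rho> \<in> Av n [1, 3, 2]"
proof
  assume \<pi>: "\<pi> \<in> Av n [1, 3, 2]"
  have False if h: "1 \<le> i" "i < j" "j < k" "k \<le> n" "\<rho> i < \<rho> k" "\<rho> k < \<rho> j" for i j k
  proof -
    have "k \<noteq> n" using h slides_to_basic(5) Sym_bounds[OF slides_to_basic(2), of j] by auto
    then have "\<pi> (Suc i) < \<pi> (Suc k)" "\<pi> (Suc k) < \<pi> (Suc j)"
      using h by (simp_all add: slides_to_Suc)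
    then show False using Av_132D[OF \<pi>, of "Suc i" "Suc j" "Suc k"] h \<open>k \<noteq> n\<close> by simp
  qed
  then show "\<rho> \<in> Av n [1, 3, 2]" unfolding in_Av_132 using slides_to_basic(2) by blast
next
  assume \<rho>: "\<rho> \<in> Av n [1, 3, 2]"
  have *: False if h: "2 \<le> i" "i < j" "j < k" "k \<le> n" "\<pi> i < \<pi> k" "\<pi> k < \<pi> j" for i j k
  proof -
    obtain i' j' k' where "i = Suc i'" "j = Suc j'" "k = Suc k'"
      using h by (cases i; cases j; cases k) auto
    then show False
      using Av_132D[OF \<rho>, of i' j' k'] h slides_to_less_iff[of i' k'] slides_to_less_iff[of k' j'] by simp
  qed
  have False if h: "1 \<le> i" "i < j" "j < k" "k \<le> n" "\<pi> i < \<pi> k" "\<pi> k < \<pi> j" for i j k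
  proof (cases "i = 1")
    case True
    have "j \<noteq> 2" using h True slides_to_basic(6) by auto
    moreover have "\<pi> k \<noteq> \<pi> 2" using h True Sym_inj[OF slides_to_basic(1), of k 2] by auto
    ultimately show False using *[of 2 j k] h True slides_to_basic(6) by auto
  next
    case False
    then show False using *[of i j k] h by auto
  qed
  then show "\<pi> \<in> Av n [1, 3, 2]" unfolding in_Av_132 using slides_to_basic(1) by blast
qed

text \<open>The first entries agree, and every later left-to-right minimum is smaller than these and hence
  not shifted in value.\<close>

lemma slides_to_LMIN: "LMIN n \<pi> = LMIN n \<rho>"
proof -
  have n: "n \<ge> 2" by (rule slides_to_basic)
  have low: "\<pi> (Suc i) = \<rho> i" if "1 \<le> i" "i < n" "\<rho> i < \<pi> 1" for i
    using that slides_to_Suc by (simp add: lift_above_def)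
  have "v \<in> LMIN n \<rho>" if "v \<in> LMIN n \<pi>" for v
  proof -
    from that obtain i where i: "v = \<pi> i" "1 \<le> i" "i \<le> n" "\<And>j. 1 \<le> j \<Longrightarrow> j < i \<Longrightarrow> \<pi> i < \<pi> j"
      unfolding LMIN_def by auto
    show ?thesis
    proof (cases "i = 1")
      case True
      then show ?thesis using i(1) n slides_to_basic(4) by (auto simp: LMIN_def intro!: exI[of _ 1])
    next
      case False
      then obtain l where l: "i = Suc l" "1 \<le> l" using i(2) by (cases i) auto
      have "\<pi> (Suc l) < \<pi> 1" using i(4)[of 1] l by auto
      then have "\<rho> l < \<pi> 1" using slides_to_Suc[of l] l i(3) by (auto simp: lift_above_def split: if_splits)
      then have "v = \<rho> l" using low[of l] i(1,3) l by auto
      moreover have "\<rho> l < \<rho> j" if "1 \<le> j" "j < l" for j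
        using i(4)[of "Suc j"] that slides_to_less_iff[of l j] l i(3) by auto
      ultimately show ?thesis using l i(3) by (auto simp: LMIN_def intro!: exI[of _ l])
    qed
  qed
  moreover have "v \<in> LMIN n \<pi>" if "v \<in> LMIN n \<rho>" for v
  proof -
    from that obtain i where i: "v = \<rho> i" "1 \<le> i" "i \<le> n" "\<And>j. 1 \<le> j \<Longrightarrow> j < i \<Longrightarrow> \<rho> i < \<rho> j"
      unfolding LMIN_def by auto
    show ?thesis
    proof (cases "i = 1")
      case True
      then show ?thesis using i(1) n slides_to_basic(4) by (auto simp: LMIN_def intro!: exI[of _ 1])
    next
      case False
      then have lt: "\<rho> i < \<pi> 1" using i(2) i(4)[of 1] slides_to_basic(4) by auto
      then have "i \<noteq> n" using slides_to_basic(5) Sym_bounds[OF slides_to_basic(1), of 1] n by auto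
      then have v: "v = \<pi> (Suc i)" using low[of i] i lt by auto
      have "\<pi> (Suc i) < \<pi> j" if j: "1 \<le> j" "j < Suc i" for j
      proof (cases "j = 1")
        case True
        then show ?thesis using v i(1) lt by simp
      next
        case False
        then obtain l where "j = Suc l" "1 \<le> l" using j by (cases j) auto
        then show ?thesis using i j slides_to_less_iff[of i l] \<open>i \<noteq> n\<close> by auto
      qed
      then show ?thesis using v i \<open>i \<noteq> n\<close> by (auto simp: LMIN_def intro!: exI[of _ "Suc i"])
    qed
  qed
  ultimately show ?thesis by blast
qed

text \<open>Descents move one position to the left and none is lost or created at the ends. As \<open>\<pi>\<close> is not
  increasing, a descent exists and determines the initial run.\<close>

lemma slides_to_iar:
  assumes "\<pi> 1 \<noteq> 1"
  shows "iar n \<pi> = Suc (iar n \<rho>)"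
proof -
  have n: "n \<ge> 2" by (rule slides_to_basic)
  have "i \<in> DES n \<pi> \<longleftrightarrow> i \<in> Suc ` DES n \<rho>" for i
  proof (cases i)
    case (Suc l)
    show ?thesis
    proof (cases "l = 0")
      case True
      then show ?thesis using Suc slides_to_basic(6) by (auto simp: DES_def numeral_2_eq_2)
    next
      case False
      have "Suc l \<in> DES n \<pi> \<longleftrightarrow> l \<in> DES n \<rho>"
      proof (cases "Suc l < n")
        case True
        then show ?thesis using False slides_to_less_iff[of "Suc l" l] by (auto simp: DES_def)
      next
        case f: False
        have "l \<notin> DES n \<rho>"
        proof
          assume "l \<in> DES n \<rho>"
          then have "1 \<le> l" "l < n" "\<rho> (Suc l) < \<rho> l" by (auto simp: DES_def)
          moreover from this have "Suc l = n" using f by simp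
          ultimately show False using slides_to_basic(5) Sym_bounds[OF slides_to_basic(2), of l] by auto
        qed
        then show ?thesis using f by (auto simp: DES_def)
      qed
      then show ?thesis using Suc by auto
    qed
  qed (auto simp: DES_def)
  then have D: "DES n \<pi> = Suc ` DES n \<rho>" by blast
  have "DES n \<pi> \<noteq> {}"
  proof
    assume e: "DES n \<pi> = {}"
    have up: "\<pi> i \<le> \<pi> (Suc i)" if "1 \<le> i" "i < n" for i
    proof -
      have "i \<notin> DES n \<pi>" using e by auto
      then show ?thesis using that by (auto simp: DES_def)
    qed
    have mono: "1 \<le> i \<Longrightarrow> i \<le> n \<Longrightarrow> \<pi> 1 \<le> \<pi> i" for i
    proof (induction i)
      case (Suc i)
      then show ?case using up[of i] by (cases "i = 0") auto
    qed auto
    obtain p where "1 \<le> p" "p \<le> n" "\<pi> p = 1"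
      using Sym_surj[OF slides_to_basic(1), of 1] n by auto
    then show False using mono[of p] assms Sym_bounds[OF slides_to_basic(1), of 1] n by auto
  qed
  then have ne: "DES n \<rho> \<noteq> {}" using D by auto
  have *: "Min (X \<union> {n}) = Min X" if "X \<noteq> {}" "X \<subseteq> {1..n-1}" for X :: "nat set"
  proof -
    have fin: "finite X" using that(2) finite_subset by blast
    then have "Min X \<le> n" using Min_in[of X] that by fastforce
    then show ?thesis using that(1) fin by (simp only: Min_Un finite.intros not_False_eq_True
      insert_not_empty Min_singleton min_absorb1)
  qed
  have sub: "DES n \<sigma> \<subseteq> {1..n-1}" for \<sigma> by (auto simp: DES_def)
  have "iar n \<pi> = Min (Suc ` DES n \<rho>)"
    using *[of "DES n \<pi>"] D ne sub[of \<pi>] by (simp add: iar_def)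
  also have "\<dots> = Suc (Min (DES n \<rho>))"
    using ne finite_DES by (intro mono_Min_commute[symmetric]) (auto simp: mono_def)
  also have "Min (DES n \<rho>) = iar n \<rho>"
    using *[of "DES n \<rho>"] ne sub by (simp add: iar_def)
  finally show ?thesis .
qed

text \<open>The components that end at \<open>i + 1\<close> in \<open>\<pi>\<close> correspond to those that end at \<open>i < n\<close> in \<open>\<rho>\<close>; the
  appended \<open>n\<close> is an additional one. For \<open>\<pi> 1 = 1\<close> the component ending at 1 in \<open>\<pi>\<close> would have no
  counterpart.\<close>

lemma slides_to_comps:
  assumes "\<pi> 1 \<noteq> 1"
  shows "Suc (comps n \<pi>) = comps n \<rho>"
proof -
  have n: "n \<ge> 2" by (rule slides_to_basic)
  define C where "C = (\<lambda>(\<sigma> :: nat \<Rightarrow> nat) i. \<forall>j \<in> {1..i}. \<sigma> j \<le> i)"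
  have iff: "C \<rho> i \<longleftrightarrow> C \<pi> (Suc i)" if i: "1 \<le> i" "i < n" for i
  proof
    assume C: "C \<rho> i"
    have "\<pi> j \<le> Suc i" if j: "j \<in> {1..Suc i}" for j
    proof (cases "j = 1")
      case True
      then show ?thesis using C i slides_to_basic(4) by (auto simp: C_def dest!: bspec[of _ _ 1])
    next
      case False
      then obtain l where "j = Suc l" "1 \<le> l" using j by (cases j) auto
      then show ?thesis using slides_to_Suc[of l] i j C by (auto simp: C_def lift_above_def le_SucI)
    qed
    then show "C \<pi> (Suc i)" by (simp add: C_def)
  next
    assume C: "C \<pi> (Suc i)"
    have w: "\<pi> 1 \<le> i" using C i slides_to_basic(6) by (auto simp: C_def dest!: bspec[of _ _ 2])
    have "\<rho> j \<le> i" if j: "j \<in> {1..i}" for j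
    proof -
      have "lift_above (\<pi> 1) (\<rho> j) \<le> Suc i" using C i j slides_to_Suc[of j] by (auto simp: C_def dest!: bspec[of _ _ "Suc j"])
      then show ?thesis using w by (auto simp: lift_above_def split: if_splits)
    qed
    then show "C \<rho> i" by (simp add: C_def)
  qed
  let ?X = "{i \<in> {1..<n}. C \<rho> i}"
  have "\<not> C \<pi> 1" using assms Sym_bounds[OF slides_to_basic(1), of 1] n by (auto simp: C_def)
  then have "i \<in> {i \<in> {1..n}. C \<pi> i} \<longleftrightarrow> i \<in> Suc ` ?X" for i
    using iff[of "i - 1"] by (cases "i = 1"; cases i) (auto simp: image_iff)
  then have "{i \<in> {1..n}. C \<pi> i} = Suc ` ?X" by blast
  then have "comps n \<pi> = card ?X" by (simp add: comps_def C_def card_image)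
  moreover have "C \<rho> n" using Sym_bounds[OF slides_to_basic(2)] by (auto simp: C_def)
  then have "{i \<in> {1..n}. C \<rho> i} = insert n ?X" using n by auto
  then have "comps n \<rho> = Suc (card ?X)" by (simp add: comps_def C_def)
  ultimately show ?thesis by simp
qed

end

lemma slides_to_inj1:
  assumes s: "slides_to n \<pi> \<rho>" "slides_to n \<pi>' \<rho>"
  shows "\<pi> = \<pi>'"
proof
  fix i
  have first: "\<pi> 1 = \<pi>' 1" using slides_to_basic(4)[OF s(1)] slides_to_basic(4)[OF s(2)] by simp
  show "\<pi> i = \<pi>' i"
  proof (cases "i \<in> {1..n} - {1}")
    case True
    then obtain l where "i = Suc l" "1 \<le> l" "l < n" by (cases i) auto
    then show ?thesis
      by (simp add: slides_to_Suc[OF s(1), of l] slides_to_Suc[OF s(2), of l] first[unfolded One_nat_def])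
  next
    case False
    then show ?thesis
      using first Sym_outside[OF slides_to_basic(1)[OF s(1)], of i]
        Sym_outside[OF slides_to_basic(1)[OF s(2)], of i] by (cases "i = 1") auto
  qed
qed

lemma slides_to_inj2:
  assumes s: "slides_to n \<pi> \<rho>" "slides_to n \<pi> \<rho>'"
  shows "\<rho> = \<rho>'"
proof
  fix i
  show "\<rho> i = \<rho>' i"
  proof (cases "i \<in> {1..<n}")
    case True
    then have "lift_above (\<pi> 1) (\<rho> i) = lift_above (\<pi> 1) (\<rho>' i)"
      using slides_to_Suc[OF s(1), of i] slides_to_Suc[OF s(2), of i] by simp
    then show ?thesis by (auto simp: lift_above_def split: if_splits)
  next
    case False
    then show ?thesis
      using slides_to_basic(5)[OF s(1)] slides_to_basic(5)[OF s(2)]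
        Sym_outside[OF slides_to_basic(2)[OF s(1)], of i]
        Sym_outside[OF slides_to_basic(2)[OF s(2)], of i] by (cases "i = n") auto
  qed
qed

lemma ex_slides_to_backward:
  assumes \<rho>: "\<rho> \<in> Sym n" and n: "n \<ge> 2" and last: "\<rho> n = n"
  shows "\<exists>\<pi>. slides_to n \<pi> \<rho>"
proof -
  define \<pi> where "\<pi> = (\<lambda>i. if i = 1 then \<rho> 1 else if i \<in> {2..n} then lift_above (\<rho> 1) (\<rho> (i - 1)) else i)"
  have lt: "\<rho> i < n" if "1 \<le> i" "i < n" for i
    using Sym_bounds[OF \<rho>, of i] Sym_inj[OF \<rho>, of i n] last that by auto
  have "\<pi> \<in> Sym n"
  proof (rule SymI)
    show "\<pi> i \<in> {1..n}" if "i \<in> {1..n}" for i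
    proof (cases "i = 1")
      case True
      then show ?thesis using Sym_bounds[OF \<rho>, of 1] n by (simp add: \<pi>_def)
    next
      case False
      then have "1 \<le> i - 1" "i - 1 < n" using that by auto
      then show ?thesis using lt[of "i - 1"] Sym_bounds[OF \<rho>, of "i - 1"] that False
        by (simp add: \<pi>_def lift_above_def)
    qed
    show "inj_on \<pi> {1..n}"
    proof (rule linorder_inj_onI)
      fix i j assume ij: "i < j" "i \<in> {1..n}" "j \<in> {1..n}"
      have j: "\<pi> j = lift_above (\<rho> 1) (\<rho> (j - 1))" using ij by (auto simp: \<pi>_def)
      show "\<pi> i \<noteq> \<pi> j"
      proof (cases "i = 1")
        case True
        then show ?thesis unfolding j by (simp add: \<pi>_def)
      next
        case False
        then have "\<pi> i = lift_above (\<rho> 1) (\<rho> (i - 1))" using ij by (auto simp: \<pi>_def)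
        moreover have "\<rho> (i - 1) \<noteq> \<rho> (j - 1)" using Sym_inj[OF \<rho>] ij False by auto
        ultimately show ?thesis unfolding j by (auto simp: lift_above_def)
      qed
    qed auto
    show "\<pi> i = i" if "i \<notin> {1..n}" for i using that n by (auto simp: \<pi>_def)
  qed
  then have "slides_to n \<pi> \<rho>" using \<rho> n last by (auto simp: slides_to_def \<pi>_def)
  then show ?thesis by blast
qed

lemma ex_slides_to_forward:
  assumes \<pi>: "\<pi> \<in> Sym n" and n: "n \<ge> 2" and second: "\<pi> 2 = Suc (\<pi> 1)"
  shows "\<exists>\<rho>. slides_to n \<pi> \<rho>"
proof -
  define \<rho> where "\<rho> = (\<lambda>i. if i \<in> {1..<n} then (if \<pi> (Suc i) < \<pi> 1 then \<pi> (Suc i) else \<pi> (Suc i) - 1) else i)"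
  have ne: "\<pi> (Suc i) \<noteq> \<pi> 1" if "1 \<le> i" for i using Sym_inj[OF \<pi>, of "Suc i" 1] that by auto
  have lift: "\<pi> (Suc i) = lift_above (\<pi> 1) (\<rho> i)" if "1 \<le> i" "i < n" for i
    using ne[of i] that by (auto simp: \<rho>_def lift_above_def)
  have rng: "1 \<le> \<rho> i \<and> \<rho> i < n" if "1 \<le> i" "i < n" for i
    using that Sym_bounds[OF \<pi>, of "Suc i"] Sym_bounds[OF \<pi>, of 1] ne[of i] n
    by (auto simp: \<rho>_def)
  have "\<rho> \<in> Sym n"
  proof (rule SymI)
    show "\<rho> i \<in> {1..n}" if "i \<in> {1..n}" for i
      using rng[of i] that n by (cases "i = n") (auto simp: \<rho>_def)
    show "inj_on \<rho> {1..n}"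
    proof (rule linorder_inj_onI)
      fix i j assume ij: "i < j" "i \<in> {1..n}" "j \<in> {1..n}"
      show "\<rho> i \<noteq> \<rho> j"
      proof (cases "j = n")
        case True
        then show ?thesis using rng[of i] ij by (auto simp: \<rho>_def)
      next
        case False
        then show ?thesis using lift[of i] lift[of j] ij Sym_inj[OF \<pi>, of "Suc i" "Suc j"] by auto
      qed
    qed auto
    show "\<rho> i = i" if "i \<notin> {1..n}" for i using that by (auto simp: \<rho>_def)
  qed
  moreover have "\<rho> 1 = \<pi> 1" using n second by (simp add: \<rho>_def numeral_2_eq_2)
  moreover have "\<rho> n = n" by (simp add: \<rho>_def)
  ultimately have "slides_to n \<pi> \<rho>" using \<pi> n lift by (simp add: slides_to_def)
  then show ?thesis by blast
qed

lemma LMIN_first: "n \<ge> 1 \<Longrightarrow> \<pi> 1 \<in> LMIN n \<pi>"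
  by (auto simp: LMIN_def intro!: exI[of _ 1])

text \<open>The entries after a leading 1 contain no descent, which would complete a 132.\<close>

lemma Av_132_id_if_first_1:
  assumes \<pi>: "\<pi> \<in> Av n [1, 3, 2]" and "\<pi> 1 = 1"
  shows "\<pi> = id"
proof -
  note S = Av_Sym[OF \<pi>]
  have less: "\<pi> i < \<pi> j" if "1 \<le> i" "i < j" "j \<le> n" for i j
  proof (cases "i = 1")
    case True
    then show ?thesis using that assms(2) Sym_bounds[OF S, of j] Sym_inj[OF S, of j 1] by auto
  next
    case False
    have "\<not> (\<pi> 1 < \<pi> j \<and> \<pi> j < \<pi> i)" using Av_132D[OF \<pi>, of 1 i j] that False by auto
    then show ?thesis
      using that assms(2) Sym_bounds[OF S, of j] Sym_inj[OF S, of j 1] Sym_inj[OF S, of j i] by auto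
  qed
  have ge: "i \<le> n \<Longrightarrow> i \<le> \<pi> i" for i
  proof (induction i)
    case (Suc i)
    then show ?case using less[of i "Suc i"] assms(2) by (cases "i = 0") auto
  qed auto
  have "\<pi> i = i" for i
  proof (induction i rule: measure_induct_rule[where f = "\<lambda>i. n - i"])
    case (less i)
    show ?case
    proof (cases "i \<in> {1..n}")
      case True
      then have "i \<le> \<pi> i" "\<pi> i \<le> n" using ge Sym_bounds[OF S, of i] by auto
      moreover have "\<not> i < \<pi> i"
      proof
        assume lt: "i < \<pi> i"
        then have "\<pi> (\<pi> i) = \<pi> i" using \<open>\<pi> i \<le> n\<close> by (intro less.IH) auto
        then show False using lt Sym_inj[OF S, of "\<pi> i" i] by simp
      qed
      ultimately show ?thesis by simp
    qed (rule Sym_outside[OF S])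
  qed
  then show ?thesis by auto
qed

text \<open>Otherwise the value \<open>\<pi> 1 + 1\<close> occurs later and is the 2 of a 132 that starts with \<open>\<pi> 1\<close> and \<open>\<pi> 2\<close>.\<close>

lemma Av_132_second:
  assumes \<pi>: "\<pi> \<in> Av n [1, 3, 2]" and "n \<ge> 2" "\<pi> 1 < \<pi> 2"
  shows "\<pi> 2 = Suc (\<pi> 1)"
proof (rule ccontr)
  assume ne: "\<pi> 2 \<noteq> Suc (\<pi> 1)"
  note S = Av_Sym[OF \<pi>]
  have "Suc (\<pi> 1) \<le> n" using assms Sym_bounds[OF S, of 2] by auto
  then obtain p where p: "1 \<le> p" "p \<le> n" "\<pi> p = Suc (\<pi> 1)" using Sym_surj[OF S, of "Suc (\<pi> 1)"] by auto
  then have "p \<noteq> 1" "p \<noteq> 2" using ne by auto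
  then show False using Av_132D[OF \<pi>, of 1 2 p] assms(3) p ne by auto
qed

text \<open>If the first \<open>i < n\<close> entries form a union of components, everything after them exceeds \<open>\<pi> 1\<close> and must be
  increasing, so the maximum stands at the end.\<close>

lemma Av_132_last:
  assumes \<pi>: "\<pi> \<in> Av n [1, 3, 2]" and "comps n \<pi> \<ge> 2"
  shows "\<pi> n = n" "n \<ge> 2"
proof -
  note S = Av_Sym[OF \<pi>]
  let ?X = "{i \<in> {1..n}. \<forall>j \<in> {1..i}. \<pi> j \<le> i}"
  have "\<not> ?X \<subseteq> {n}"
    using assms(2) card_mono[of "{n}" ?X] unfolding comps_def by auto
  then obtain i where "i \<in> ?X" "i \<noteq> n" by blast
  then have i: "1 \<le> i" "i < n" "\<And>j. j \<in> {1..i} \<Longrightarrow> \<pi> j \<le> i" by auto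
  then show "n \<ge> 2" by simp
  have img: "\<pi> ` {1..i} = {1..i}"
  proof (rule endo_inj_surj)
    show "\<pi> ` {1..i} \<subseteq> {1..i}" using i Sym_bounds[OF S] by fastforce
  qed (auto simp: inj_on_def Sym_inj[OF S])
  have out: "\<pi> k > i" if k: "i < k" "k \<le> n" for k
  proof (rule ccontr)
    assume "\<not> i < \<pi> k"
    then have "\<pi> k \<in> \<pi> ` {1..i}" using img Sym_bounds[OF S, of k] i k by auto
    then show False using k by (auto simp: Sym_inj[OF S])
  qed
  show "\<pi> n = n"
  proof (rule ccontr)
    assume ne: "\<pi> n \<noteq> n"
    obtain p where p: "1 \<le> p" "p \<le> n" "\<pi> p = n" using Sym_surj[OF S, of n] i by auto
    have "p < n" using p ne by (cases "p = n") auto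
    moreover have "i < p" using p i(3)[of p] i(2) by (cases "p \<le> i") auto
    moreover have "\<pi> 1 < \<pi> n" using le_less_trans[OF i(3)[of 1] out[of n]] i(1,2) by simp
    moreover have "\<pi> n < \<pi> p" using p ne Sym_bounds[OF S, of n] i by auto
    ultimately show False using Av_132D[OF \<pi>, of 1 p n] i(1) by auto
  qed
qed

lemma card_eq_if_one_to_one:
  assumes "\<And>x. x \<in> A \<Longrightarrow> \<exists>y\<in>B. R x y" "\<And>y. y \<in> B \<Longrightarrow> \<exists>x\<in>A. R x y"
    and "\<And>x x' y. R x y \<Longrightarrow> R x' y \<Longrightarrow> x = x'" "\<And>x y y'. R x y \<Longrightarrow> R x y' \<Longrightarrow> y = y'"
  shows "card A = card B"
proof -
  obtain f where f: "\<And>x. x \<in> A \<Longrightarrow> f x \<in> B \<and> R x (f x)"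
    using assms(1) by metis
  have "bij_betw f A B"
    unfolding bij_betw_def inj_on_def
  proof (intro conjI ballI impI equalityI subsetI)
    show "x = x'" if "x \<in> A" "x' \<in> A" "f x = f x'" for x x'
      using f[OF that(1)] f[OF that(2)] that(3) assms(3) by metis
    show "y \<in> B" if "y \<in> f ` A" for y using f that by blast
    show "y \<in> f ` A" if "y \<in> B" for y
      using assms(2)[OF that] f assms(4) by (metis imageI)
  qed
  then show ?thesis by (rule bij_betw_same_card)
qed

text \<open>The bounds \<open>1 \<le> a\<close> and \<open>1 \<le> b\<close> make the slide possible in both directions: a run of length at least 2
  provides \<open>\<pi> 2 = \<pi> 1 + 1\<close>, and at least two components provide \<open>\<rho> n = n\<close>. The set \<open>{1}\<close> is the
  value of \<open>LMIN\<close> for the identity, which has no descent to move.\<close>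

lemma card_slide:
  assumes ab: "1 \<le> a" "1 \<le> b" and V: "V \<noteq> {1}" and n: "n \<ge> 1"
  shows "card {\<pi> \<in> Av n [1, 3, 2]. LMIN n \<pi> = V \<and> iar n \<pi> = Suc a \<and> comps n \<pi> = b} =
    card {\<pi> \<in> Av n [1, 3, 2]. LMIN n \<pi> = V \<and> iar n \<pi> = a \<and> comps n \<pi> = Suc b}"
    (is "card ?A = card ?B")
proof -
  note S = Av_Sym
  have first: "\<pi> 1 \<noteq> 1" if "\<pi> \<in> Av n [1, 3, 2]" "LMIN n \<pi> = V" for \<pi>
  proof
    assume "\<pi> 1 = 1"
    then have "\<pi> = id" using Av_132_id_if_first_1 that(1) by blast
    then have "v = 1" if "v \<in> LMIN n \<pi>" for v
      using that by (auto simp: LMIN_def dest!: bspec[of _ _ 1])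
    moreover have "1 \<in> LMIN n \<pi>" using LMIN_first[OF n, of \<pi>] \<open>\<pi> 1 = 1\<close> by simp
    ultimately show False using that V by blast
  qed
  have AB: "\<rho> \<in> ?B \<longleftrightarrow> \<pi> \<in> ?A" if sl: "slides_to n \<pi> \<rho>" for \<pi> \<rho>
    using slides_to_avoids_132[OF sl] slides_to_LMIN[OF sl] slides_to_iar[OF sl]
      slides_to_comps[OF sl] first[of \<pi>] by auto
  have exA: "\<exists>\<rho>. slides_to n \<pi> \<rho>" if "\<pi> \<in> ?A" for \<pi>
  proof (rule ex_slides_to_forward)
    have i: "iar n \<pi> \<ge> 2" using that ab by auto
    have "iar n \<pi> \<le> n" by (auto simp: iar_def finite_DES)
    then show n2: "n \<ge> 2" using i by simp
    have "1 \<notin> DES n \<pi>"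
    proof
      assume "1 \<in> DES n \<pi>"
      then have "iar n \<pi> \<le> 1" by (auto simp: iar_def finite_DES)
      then show False using i by simp
    qed
    moreover have "\<pi> 1 \<noteq> \<pi> 2" 
    proof -
      have "\<pi> \<in> Sym n" using that S by blast
      then show ?thesis using Sym_inj[of \<pi> n 1 2] by simp
    qed
    ultimately have "\<pi> 1 < \<pi> 2" using n2 by (auto simp: DES_def numeral_2_eq_2)
    then show "\<pi> 2 = Suc (\<pi> 1)" using Av_132_second n2 that by auto
  qed (use that S in auto)
  have exB: "\<exists>\<pi>. slides_to n \<pi> \<rho>" if "\<rho> \<in> ?B" for \<rho>
    using that ab Av_132_last[of \<rho> n] S by (intro ex_slides_to_backward) auto
  show ?thesis
  proof (rule card_eq_if_one_to_one[where R = "slides_to n"])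
    show "\<exists>\<rho>\<in>?B. slides_to n \<pi> \<rho>" if "\<pi> \<in> ?A" for \<pi>
      using exA[OF that] AB that by blast
    show "\<exists>\<pi>\<in>?A. slides_to n \<pi> \<rho>" if "\<rho> \<in> ?B" for \<rho>
      using exB[OF that] AB that by blast
  qed (use slides_to_inj1 slides_to_inj2 in blast)+
qed

lemma jointly_symmetric_Av_132:
  assumes n: "n \<ge> 1"
  shows "jointly_symmetric (Av n [1, 3, 2]) (LMIN n) (iar n) (comps n)"
  unfolding jointly_symmetric_def
proof (intro allI)
  fix V a b
  let ?N = "\<lambda>a b. card {\<pi> \<in> Av n [1, 3, 2]. LMIN n \<pi> = V \<and> iar n \<pi> = a \<and> comps n \<pi> = b}"
  show "?N a b = ?N b a"
  proof (cases "V = {1}")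
    case True
    have "iar n \<pi> = comps n \<pi>" if "\<pi> \<in> Av n [1, 3, 2]" "LMIN n \<pi> = V" for \<pi>
    proof -
      have "\<pi> 1 = 1" using LMIN_first[OF n, of \<pi>] that True by auto
      then have "\<pi> = id" using Av_132_id_if_first_1 that(1) by blast
      moreover have "{i \<in> {1..n}. \<forall>j \<in> {1..i}. id j \<le> i} = {1..n}" by auto
      ultimately show ?thesis by (simp add: iar_def comps_def DES_def)
    qed
    then have "{\<pi> \<in> Av n [1, 3, 2]. LMIN n \<pi> = V \<and> iar n \<pi> = a \<and> comps n \<pi> = b} =
      {\<pi> \<in> Av n [1, 3, 2]. LMIN n \<pi> = V \<and> iar n \<pi> = b \<and> comps n \<pi> = a}" by auto
    then show ?thesis by (simp only:)
  next
    case False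
    show ?thesis
    proof (rule symmetric_if_constant_on_antidiagonals[where m = 1 and N = ?N])
      show "?N (Suc a) b = ?N a (Suc b)" if "1 \<le> a" "1 \<le> b" for a b
        using card_slide[OF that False n] .
      show "?N a b = 0" if "a < 1 \<or> b < 1" for a b
      proof -
        have "iar n \<pi> \<noteq> a \<or> comps n \<pi> \<noteq> b" if "\<pi> \<in> Av n [1, 3, 2]" for \<pi>
          using iar_pos[OF n, of \<pi>] comps_pos[of \<pi> n] Av_Sym[OF that] n \<open>a < 1 \<or> b < 1\<close>
          by auto
        then have "{\<pi> \<in> Av n [1, 3, 2]. LMIN n \<pi> = V \<and> iar n \<pi> = a \<and> comps n \<pi> = b} = {}" by blast
        then show ?thesis by (simp only: card.empty)
      qed
    qed
  qed
qed

text \<open>Values above \<open>\<pi> 1\<close> occur in increasing order, as a larger one before a smaller one would be the 32 of a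
  132. So all of them are left-to-right maxima.\<close>

lemma LMAX_Av_132:
  assumes \<pi>: "\<pi> \<in> Av n [1, 3, 2]" and n: "n \<ge> 1"
  shows "LMAX n \<pi> = {Max (LMIN n \<pi>)..n}"
proof -
  note S = Av_Sym[OF \<pi>]
  have "LMIN n \<pi> \<subseteq> \<pi> ` {1..n}" by (auto simp: LMIN_def)
  then have "finite (LMIN n \<pi>)" by (rule finite_subset) simp
  moreover have "v \<le> \<pi> 1" if "v \<in> LMIN n \<pi>" for v
  proof -
    from that obtain i where i: "v = \<pi> i" "1 \<le> i" "\<forall>j\<in>{1..<i}. \<pi> i < \<pi> j"
      unfolding LMIN_def by auto
    then have "\<pi> i < \<pi> 1" if "i \<noteq> 1" using that by simp
    then show ?thesis using i(1) by (cases "i = 1") auto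
  qed
  ultimately have M: "Max (LMIN n \<pi>) = \<pi> 1"
    using LMIN_first[OF n, of \<pi>] by (intro Max_eqI)
  have "v \<in> LMAX n \<pi>" if v: "\<pi> 1 \<le> v" "v \<le> n" for v
  proof -
    obtain i where i: "1 \<le> i" "i \<le> n" "\<pi> i = v"
      using Sym_surj[OF S, of v] v Sym_bounds[OF S, of 1] n by auto
    have "\<pi> j < \<pi> i" if j: "1 \<le> j" "j < i" for j
    proof (rule ccontr)
      assume "\<not> \<pi> j < \<pi> i"
      then have ji: "\<pi> i < \<pi> j" using Sym_inj[OF S, of i j] j by auto
      then have "j \<noteq> 1" using i(3) v(1) by auto
      moreover have "\<pi> 1 \<noteq> \<pi> i" using Sym_inj[OF S, of 1 i] j by auto
      ultimately show False using Av_132D[OF \<pi>, of 1 j i] ji i v(1) j by simp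
    qed
    then show ?thesis using i by (auto simp: LMAX_def)
  qed
  moreover have "\<pi> 1 \<le> v \<and> v \<le> n" if "v \<in> LMAX n \<pi>" for v
  proof -
    from that obtain i where i: "v = \<pi> i" "1 \<le> i" "i \<le> n" "\<forall>j\<in>{1..<i}. \<pi> j < \<pi> i"
      unfolding LMAX_def by auto
    then have "\<pi> 1 < \<pi> i" if "i \<noteq> 1" using that by simp
    then have "\<pi> 1 \<le> \<pi> i" by (cases "i = 1") auto
    then show ?thesis using i(1) Sym_bounds[OF S i(2,3)] by simp
  qed
  ultimately have "v \<in> LMAX n \<pi> \<longleftrightarrow> v \<in> {\<pi> 1..n}" for v
    unfolding atLeastAtMost_iff by blast
  then show ?thesis unfolding M by blast
qed

section \<open>The three equidistributions\<close>

theorem theorem1p1: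
  fixes n :: nat
  assumes "n \<ge> 1"
  shows "equidistributed (Av n [3, 2, 1])
           (\<lambda>\<pi>. (LMAX n \<pi>, iar n \<pi>, comps n \<pi>))
           (\<lambda>\<pi>. (LMAX n \<pi>, comps n \<pi>, iar n \<pi>))
       \<and> equidistributed (Av n [3, 1, 2])
           (\<lambda>\<pi>. (LMAX n \<pi>, DESB n \<pi>, iar n \<pi>, comps n \<pi>))
           (\<lambda>\<pi>. (LMAX n \<pi>, DESB n \<pi>, comps n \<pi>, iar n \<pi>))
       \<and> equidistributed (Av n [1, 3, 2])
           (\<lambda>\<pi>. (LMAX n \<pi>, LMIN n \<pi>, iar n \<pi>, comps n \<pi>))
           (\<lambda>\<pi>. (LMAX n \<pi>, LMIN n \<pi>, comps n \<pi>, iar n \<pi>))"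
proof (intro conjI)
  have sym: "jointly_symmetric (Av n w) (LMAX n) (iar n) (comps n)"
    if "w = [3, 2, 1] \<or> w = [3, 1, 2]" for w
    using jointly_symmetric_if_bij_betw_pmax[OF assms _ bij_betw_pmax[OF that]] Av_Sym by blast
  show "equidistributed (Av n [3, 2, 1])
      (\<lambda>\<pi>. (LMAX n \<pi>, iar n \<pi>, comps n \<pi>)) (\<lambda>\<pi>. (LMAX n \<pi>, comps n \<pi>, iar n \<pi>))"
    by (rule equidistributed_if_jointly_symmetric[OF sym, where h = "\<lambda>V. V" and h' = "\<lambda>V. V"]) simp_all
  show "equidistributed (Av n [3, 1, 2])
      (\<lambda>\<pi>. (LMAX n \<pi>, DESB n \<pi>, iar n \<pi>, comps n \<pi>))
      (\<lambda>\<pi>. (LMAX n \<pi>, DESB n \<pi>, comps n \<pi>, iar n \<pi>))"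
    by (rule equidistributed_quadruple, rule equidistributed_if_jointly_symmetric[OF sym,
        where h = "\<lambda>V. (V, {1..n} - V)" and h' = fst])
      (simp_all add: DESB_Av_312[OF _ assms] del: One_nat_def)
  show "equidistributed (Av n [1, 3, 2])
      (\<lambda>\<pi>. (LMAX n \<pi>, LMIN n \<pi>, iar n \<pi>, comps n \<pi>))
      (\<lambda>\<pi>. (LMAX n \<pi>, LMIN n \<pi>, comps n \<pi>, iar n \<pi>))"
    by (rule equidistributed_quadruple, rule equidistributed_if_jointly_symmetric[OF
        jointly_symmetric_Av_132[OF assms], where h = "\<lambda>V. ({Max V..n}, V)" and h' = snd])
      (simp_all add: LMAX_Av_132[OF _ assms] del: One_nat_def)
qed

end
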